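(* Let $k\ge2$, $\delta\in[0,1]$, and let $G$ be a $k$-player game whose question distribution has uniform marginals for each player. Suppose $G'$ is obtained by concatenating each of the $k$ sides of $G$ with a bipartite $\lambda$-spectral expander, where $\lambda\le 2\delta/k$. Then $G'$ is $(0,\delta)$-fortified against classical substrategies; that is, for every classical substrategy $(f_1,\dots,f_k)$ for $G'$, $$\mathrm{Val}(G',\{f_i\}_{i=1}^k)\le\mathrm{Val}(G')\cdot\mathop{\mathbb E}_{(x_1,\dots,x_k)\sim\mu}\prod_{i=1}^kf_i(x_i)+\delta .$$
   Context: A $k$-player game $G$ consists of finite question sets $X_1,\dots,X_k$, finite answer sets $A_1,\dots,A_k$, a probability distribution $\mu$ on $X_1\times\dots\times X_k$ and a predicate $V(a_1,\dots,a_k,x_1,\dots,x_k)\in\{0,1\}$. Concatenation. Let $M_i$ be a bipartite graph on vertex sets $(X_i',X_i)$, $i=1,\dots,k$, with $N(\cdot)$ denoting neighbour sets. In the concatenated game $G'$ the referee samples $(x_1,\dots,x_k)\sim\mu$ and independently a uniformly random neighbour $x_i'\sim N(x_i)$ in $M_i$ for each $i$; player $i$ receives $x_i'$ and answers with a map $a_i':N(x_i')\to A_i$; the players win iff $V(a_1'(x_1),\dots,a_k'(x_k),x_1,\dots,x_k)=1$. Substrategies. A classical substrategy for $G'$ is a tuple of nonnegative functions $f_i(x_i',a_i')$ with $\sum_{a_i'}f_i(x_i',a_i')\le1$ for every $x_i'\in X_i'$; it is a complete strategy if equality always holds. Its value $\mathrm{Val}(G',\{f_i\})$ is the expectation over the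 referee's choices of $\sum_{a_1',\dots,a_k'}V(a_1'(x_1),\dots,a_k'(x_k),x_1,\dots,x_k)\prod_if_i(x_i',a_i')$, and $\mathrm{Val}(G')$ is the supremum of the value over complete strategies. The totals on the inner game are $f_i(x_i)=\mathbb E_{x_i'\sim N(x_i)}\sum_{a_i'}f_i(x_i',a_i')$ for $x_i\in X_i$. Expanders. Bipartite graphs $M=(X'\times X,E)$ here are $X$-regular: $|N(x)|=d\geq 1$ for all $x\in X$. Let $\mu_X(x)=1/|X|$ and $\mu'(x')=\frac{|N(x')|}{d|X|}$. The normalized adjacency matrix has entries $\mathcal M(x,x')=\frac1d\sqrt{\mu_X(x)/\mu'(x')}$ if $x'\in N(x)$ and $0$ otherwise. $M$ is a $\lambda$-spectral expander if the second-largest singular value of $\mathcal M$ is at most $\lambda$. *)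

theory Defs
  imports
    "HOL-Probability.Probability"
    "HOL-Library.Countable_Set"
    "Jordan_Normal_Form.Char_Poly"
begin

section \<open>Multiplayer games\<close>

text \<open>
  Players are numbered from 1 to the number of players. A tuple indexed by the players is an
  extensional function on this index set, i.e. an element of a dependent product \<open>PiE\<close>. All
  players' questions live in one type and all their answers in another; the individual question
  and answer sets are carriers in these types.
\<close>

record ('x, 'a) game =
  players :: nat
  questions :: "nat \<Rightarrow> 'x set"
  answers :: "nat \<Rightarrow> 'a set"
  qdist :: "(nat \<Rightarrow> 'x) pmf"
  wins :: "(nat \<Rightarrow> 'a) \<Rightarrow> (nat \<Rightarrow> 'x) \<Rightarrow> bool"

definition is_game :: "('x, 'a) game \<Rightarrow> bool" where
  "is_game G \<longleftrightarrow>
     (\<forall>i\<in>{1..players G}. finite (questions G i) \<and> finite (answers G i)) \<and>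
     set_pmf (qdist G) \<subseteq> (\<Pi>\<^sub>E i\<in>{1..players G}. questions G i)"

definition uniform_marginals :: "('x, 'a) game \<Rightarrow> bool" where
  "uniform_marginals G \<longleftrightarrow>
     (\<forall>i\<in>{1..players G}. map_pmf (\<lambda>x. x i) (qdist G) = pmf_of_set (questions G i))"

section \<open>Bipartite graphs and spectral expanders\<close>

text \<open>
  The vertex classes are called \<open>outer\<close> (written \<open>X'\<close> on paper) and \<open>inner\<close> (written \<open>X\<close>).
\<close>

record ('y, 'x) bigraph =
  outer :: "'y set"
  inner :: "'x set"
  edges :: "('y \<times> 'x) set"

definition is_bigraph :: "('y, 'x) bigraph \<Rightarrow> bool" where
  "is_bigraph M \<longleftrightarrow> finite (outer M) \<and> finite (inner M) \<and> edges M \<subseteq> outer M \<times> inner M"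

definition nbrs_of_inner :: "('y, 'x) bigraph \<Rightarrow> 'x \<Rightarrow> 'y set" where
  "nbrs_of_inner M x = {x'. (x', x) \<in> edges M}"

definition nbrs_of_outer :: "('y, 'x) bigraph \<Rightarrow> 'y \<Rightarrow> 'x set" where
  "nbrs_of_outer M x' = {x. (x', x) \<in> edges M}"

definition inner_regular :: "nat \<Rightarrow> ('y, 'x) bigraph \<Rightarrow> bool" where
  "inner_regular d M \<longleftrightarrow> d \<ge> 1 \<and> (\<forall>x\<in>inner M. card (nbrs_of_inner M x) = d)"

definition mu_inner :: "('y, 'x) bigraph \<Rightarrow> 'x \<Rightarrow> real" where
  "mu_inner M x = 1 / real (card (inner M))"

definition mu_outer :: "nat \<Rightarrow> ('y, 'x) bigraph \<Rightarrow> 'y \<Rightarrow> real" where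
  "mu_outer d M x' = real (card (nbrs_of_outer M x')) / (real d * real (card (inner M)))"

definition norm_adj_entry :: "nat \<Rightarrow> ('y, 'x) bigraph \<Rightarrow> 'x \<Rightarrow> 'y \<Rightarrow> real" where
  "norm_adj_entry d M x x' =
     (if x' \<in> nbrs_of_inner M x then 1 / real d * sqrt (mu_inner M x / mu_outer d M x') else 0)"

text \<open>
  The rows are indexed by the inner and the columns by the outer vertices, through the library's
  enumeration \<open>from_nat_into S\<close>, which for finite \<open>S\<close> is a bijection from \<open>{..<card S}\<close> onto \<open>S\<close>.
  The singular values do not depend on the choice of the enumerations.
\<close>

definition norm_adj :: "nat \<Rightarrow> ('y, 'x) bigraph \<Rightarrow> real mat" where
  "norm_adj d M =
     mat (card (inner M)) (card (outer M))
       (\<lambda>(i, j). norm_adj_entry d M (from_nat_into (inner M) i) (from_nat_into (outer M) j))"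

text \<open>
  The singular values in decreasing order: the square roots of the eigenvalues of \<open>A A\<^sup>T\<close>,
  repeated according to multiplicity. The list has as many entries as \<open>A\<close> has rows; if there are
  more rows than columns, the surplus entries are zeros.
\<close>

definition singular_values :: "real mat \<Rightarrow> real list" where
  "singular_values A =
     rev (sorted_list_of_multiset (image_mset sqrt (proots (char_poly (A * transpose_mat A)))))"

text \<open>A matrix with a single row has no second singular value; it is then taken to be 0.\<close>

definition second_singular_value :: "real mat \<Rightarrow> real" where
  "second_singular_value A =
     (if length (singular_values A) \<ge> 2 then singular_values A ! 1 else 0)"

definition spectral_expander :: "real \<Rightarrow> ('y, 'x) bigraph \<Rightarrow> bool" where
  "spectral_expander l M \<longleftrightarrow>
     is_bigraph M \<and> (\<exists>d. inner_regular d M \<and> second_singular_value (norm_adj d M) \<le> l)"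

section \<open>Concatenated games\<close>

text \<open>
  The concatenation of a game \<open>G\<close> with bipartite graphs \<open>M 1\<close>, ..., \<open>M k\<close> is represented by the pair
  of \<open>G\<close> and \<open>M\<close>. The referee's sample consists of the inner questions \<open>x\<close> and the outer questions
  \<open>x'\<close> that are sent to the players.
\<close>

definition concatenable :: "('x, 'a) game \<Rightarrow> (nat \<Rightarrow> ('y, 'x) bigraph) \<Rightarrow> bool" where
  "concatenable G M \<longleftrightarrow> (\<forall>i\<in>{1..players G}. inner (M i) = questions G i)"

definition referee :: "('x, 'a) game \<Rightarrow> (nat \<Rightarrow> ('y, 'x) bigraph) \<Rightarrow> ((nat \<Rightarrow> 'x) \<times> (nat \<Rightarrow> 'y)) pmf" where
  "referee G M =
     bind_pmf (qdist G) (\<lambda>x.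
     bind_pmf (Pi_pmf {1..players G} undefined (\<lambda>i. pmf_of_set (nbrs_of_inner (M i) (x i)))) (\<lambda>x'.
     return_pmf (x, x')))"

definition outer_answers ::
  "('x, 'a) game \<Rightarrow> (nat \<Rightarrow> ('y, 'x) bigraph) \<Rightarrow> nat \<Rightarrow> 'y \<Rightarrow> ('x \<Rightarrow> 'a) set" where
  "outer_answers G M i x' = (nbrs_of_outer (M i) x' \<rightarrow>\<^sub>E answers G i)"

definition classical_substrategy ::
  "('x, 'a) game \<Rightarrow> (nat \<Rightarrow> ('y, 'x) bigraph) \<Rightarrow> (nat \<Rightarrow> 'y \<Rightarrow> ('x \<Rightarrow> 'a) \<Rightarrow> real) \<Rightarrow> bool" where
  "classical_substrategy G M f \<longleftrightarrow>
     (\<forall>i\<in>{1..players G}. \<forall>x'\<in>outer (M i).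
        (\<forall>a'\<in>outer_answers G M i x'. 0 \<le> f i x' a') \<and>
        (\<Sum>a'\<in>outer_answers G M i x'. f i x' a') \<le> 1)"

definition complete_strategy ::
  "('x, 'a) game \<Rightarrow> (nat \<Rightarrow> ('y, 'x) bigraph) \<Rightarrow> (nat \<Rightarrow> 'y \<Rightarrow> ('x \<Rightarrow> 'a) \<Rightarrow> real) \<Rightarrow> bool" where
  "complete_strategy G M f \<longleftrightarrow>
     classical_substrategy G M f \<and>
     (\<forall>i\<in>{1..players G}. \<forall>x'\<in>outer (M i). (\<Sum>a'\<in>outer_answers G M i x'. f i x' a') = 1)"

definition substrategy_value ::
  "('x, 'a) game \<Rightarrow> (nat \<Rightarrow> ('y, 'x) bigraph) \<Rightarrow> (nat \<Rightarrow> 'y \<Rightarrow> ('x \<Rightarrow> 'a) \<Rightarrow> real) \<Rightarrow> real" where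
  "substrategy_value G M f =
     measure_pmf.expectation (referee G M) (\<lambda>(x, x').
       \<Sum>a' \<in> (\<Pi>\<^sub>E i\<in>{1..players G}. outer_answers G M i (x' i)).
         of_bool (wins G (\<lambda>i\<in>{1..players G}. a' i (x i)) x) *
         (\<Prod>i\<in>{1..players G}. f i (x' i) (a' i)))"

definition concat_value :: "('x, 'a) game \<Rightarrow> (nat \<Rightarrow> ('y, 'x) bigraph) \<Rightarrow> real" where
  "concat_value G M = (SUP f\<in>{f. complete_strategy G M f}. substrategy_value G M f)"

definition inner_total ::
  "('x, 'a) game \<Rightarrow> (nat \<Rightarrow> ('y, 'x) bigraph) \<Rightarrow> (nat \<Rightarrow> 'y \<Rightarrow> ('x \<Rightarrow> 'a) \<Rightarrow> real) \<Rightarrow> nat \<Rightarrow> 'x \<Rightarrow> real" where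
  "inner_total G M f i x =
     measure_pmf.expectation (pmf_of_set (nbrs_of_inner (M i) x))
       (\<lambda>x'. \<Sum>a'\<in>outer_answers G M i x'. f i x' a')"

end

theory Submission
  imports Defs
begin

text \<open>
  Given the inner questions \<open>x\<close>, the outer questions are independent, so the value of a substrategy
  is \<open>E (\<Prod>i. t i (x i)) * w x\<close>, where \<open>t i\<close> are the totals on the inner game and \<open>w x\<close> is the winning
  probability of the normalised strategy, in which player \<open>i\<close> answers the inner question directly.
  Normalised strategies lift to complete strategies, so \<open>E w\<close> is at most the value \<open>v\<close> of the
  concatenated game. With \<open>c i\<close> the mean of \<open>t i\<close>, the excess of the value over
  \<open>v * E (\<Prod>i. t i (x i))\<close> is at most \<open>E ((\<Prod>i. t i (x i)) - (\<Prod>i. c i)) * (w x - v)\<close> and hence at most the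
  sum of the mean deviations \<open>E \<bar>t i (x i) - c i\<bar>\<close>. As \<open>t i\<close> averages a \<open>[0, 1]\<close>-valued function over the
  neighbours, each of these is at most \<open>l / 2\<close>: the standard deviation of that function is at most
  \<open>1 / 2\<close>, and averaging contracts it by the second singular value.

  The last step avoids the spectral theorem. The Gram matrix of the normalised adjacency matrix has
  row sums 1. Its quadratic form on the vectors of sum 0 is bounded by its maximum \<open>\<nu>\<close> on the unit
  sphere, which by compactness is an eigenvalue, and an explicit similarity splits off the factor
  \<open>X - 1\<close> so that \<open>(X - 1) * (X - \<nu>)\<close> divides the characteristic polynomial.
\<close>

section \<open>Eigenvalues of matrices with constant row sums\<close>

text \<open>The all-ones vector is an eigenvector for \<open>r\<close>. In a basis that starts with
  it the matrix is block upper triangular, and the lower diagonal block is the action of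
  \<open>B\<close> on the quotient by the constant vectors, with coordinates taken relative to
  coordinate 0.\<close>

lemma char_poly_constant_row_sums:
  fixes B :: "real mat"
  assumes B: "B \<in> carrier_mat (Suc m) (Suc m)"
    and row: "\<And>i. i < Suc m \<Longrightarrow> (\<Sum>j<Suc m. B $$ (i, j)) = r"
  shows "char_poly B = [:- r, 1:] * char_poly (mat m m (\<lambda>(i, j). B $$ (Suc i, Suc j) - B $$ (0, Suc j)))"
proof -
  \<comment> \<open>The columns of \<open>P\<close> are the all-ones vector, an eigenvector, and the unit vectors \<open>e\<^sub>1, \<dots>, e\<^sub>m\<close>; \<open>Q\<close> is its inverse.\<close>
  define P :: "real mat" where "P = mat (Suc m) (Suc m) (\<lambda>(i, j). if j = 0 \<or> i = j then 1 else 0)"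
  define Q :: "real mat" where
    "Q = mat (Suc m) (Suc m) (\<lambda>(i, j). if i = j then 1 else if j = 0 then - 1 else 0)"
  define B' where "B' = mat m m (\<lambda>(i, j). B $$ (Suc i, Suc j) - B $$ (0, Suc j))"
  define R where "R = mat 1 m (\<lambda>(i, j). B $$ (0, Suc j))"
  define C where "C = four_block_mat (mat 1 1 (\<lambda>_. r)) R (0\<^sub>m m 1) B'"
  have carrier [simp]: "P \<in> carrier_mat (Suc m) (Suc m)" "Q \<in> carrier_mat (Suc m) (Suc m)"
    "C \<in> carrier_mat (Suc m) (Suc m)"
    by (auto simp: P_def Q_def C_def B'_def R_def four_block_mat_def Let_def)
  \<comment> \<open>Left multiplication by \<open>P\<close> adds row 0 to every other row, and
    \<open>Q\<close> subtracts it again.\<close>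
  have PX: "(P * X) $$ (i, j) = (if i = 0 then X $$ (0, j) else X $$ (0, j) + X $$ (i, j))"
    if "X \<in> carrier_mat (Suc m) (Suc m)" "i < Suc m" "j < Suc m" for X :: "real mat" and i j
  proof -
    have "(P * X) $$ (i, j) = (\<Sum>k<Suc m. (if k = 0 \<or> i = k then 1 else 0) * X $$ (k, j))"
      using that by (simp add: P_def scalar_prod_def lessThan_atLeast0)
    also have "\<dots> = (\<Sum>k<Suc m. (if k = 0 then X $$ (0, j) else 0) + (if k = i \<and> i \<noteq> 0 then X $$ (i, j) else 0))"
      by (intro sum.cong) auto
    finally show ?thesis
      using that unfolding sum.distrib by (cases "i = 0") (simp_all del: sum.lessThan_Suc)
  qed
  have QX: "(Q * X) $$ (i, j) = (if i = 0 then X $$ (0, j) else X $$ (i, j) - X $$ (0, j))"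
    if "X \<in> carrier_mat (Suc m) (Suc m)" "i < Suc m" "j < Suc m" for X :: "real mat" and i j
  proof -
    have "(Q * X) $$ (i, j) = (\<Sum>k<Suc m. (if i = k then 1 else if k = 0 then - 1 else 0) * X $$ (k, j))"
      using that by (simp add: Q_def scalar_prod_def lessThan_atLeast0)
    also have "\<dots> = (\<Sum>k<Suc m. (if k = i then X $$ (i, j) else 0) - (if k = 0 \<and> i \<noteq> 0 then X $$ (0, j) else 0))"
      by (intro sum.cong) auto
    finally show ?thesis
      using that unfolding sum_subtractf by (cases "i = 0") (simp_all del: sum.lessThan_Suc)
  qed
  have BP: "(B * P) $$ (i, j) = (if j = 0 then r else B $$ (i, j))" if "i < Suc m" "j < Suc m" for i j
  proof -
    have "(B * P) $$ (i, j) = (\<Sum>k<Suc m. B $$ (i, k) * (if j = 0 \<or> k = j then 1 else 0))"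
      using that B by (simp add: P_def scalar_prod_def lessThan_atLeast0)
    also have "\<dots> = (if j = 0 then r else (\<Sum>k<Suc m. if k = j then B $$ (i, j) else 0))"
      unfolding row[OF that(1), symmetric]
      by (simp only: if_distrib[of "\<lambda>x. _ * x"] mult_1_right mult_zero_right split: if_split)
        (auto intro!: sum.cong simp del: sum.lessThan_Suc)
    finally show ?thesis
      using that by (simp del: sum.lessThan_Suc)
  qed
  have PQ: "P * Q = 1\<^sub>m (Suc m)" and QP: "Q * P = 1\<^sub>m (Suc m)"
    by (rule eq_matI; simp add: PX QX del: index_mult_mat; auto simp: P_def Q_def)+
  \<comment> \<open>Column 0 of \<open>B * P\<close> is constantly \<open>r\<close>; subtracting row
    0 from the others leaves the zero block below \<open>r\<close>.\<close>
  have C: "C = Q * (B * P)"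
  proof (rule eq_matI)
    fix i j assume "i < dim_row (Q * (B * P))" "j < dim_col (Q * (B * P))"
    then have ij: "i < Suc m" "j < Suc m" by (simp_all add: Q_def P_def)
    have "(Q * (B * P)) $$ (i, j) = (if i = 0 then (B * P) $$ (0, j) else (B * P) $$ (i, j) - (B * P) $$ (0, j))"
      by (rule QX[OF _ ij]) (use B in auto)
    also have "\<dots> = C $$ (i, j)"
      using ij unfolding BP[OF ij] BP[OF zero_less_Suc ij(2)]
      by (cases i; cases j) (simp_all add: C_def four_block_mat_def Let_def R_def B'_def)
    finally show "C $$ (i, j) = (Q * (B * P)) $$ (i, j)" by simp
  qed (auto simp: C_def R_def B'_def P_def Q_def)
  have "similar_mat_wit C B Q P"
    by (rule similar_mat_witI[OF QP PQ])
      (use B C carrier assoc_mult_mat[OF carrier(2) B carrier(1)] in simp_all)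
  then have "char_poly B = char_poly C"
    using char_poly_similar unfolding similar_mat_def by metis
  also have "\<dots> = char_poly (mat 1 1 (\<lambda>_. r)) * char_poly B'"
    unfolding C_def by (rule char_poly_four_block_zeros_col) (auto simp: R_def B'_def)
  also have "char_poly (mat 1 1 (\<lambda>_. r)) = [:- r, 1:]"
    by (simp add: char_poly_defs det_single)
  finally show ?thesis by (simp add: B'_def)
qed

text \<open>A nonconstant eigenvector stays nonzero modulo constants, so \<open>\<nu>\<close> is a
  root of the cofactor of \<open>X - r\<close>. Stating this for multisets covers
  \<open>\<nu> = r\<close>, where the root is counted twice.\<close>

lemma proots_constant_row_sums:
  fixes B :: "real mat"
  assumes B: "B \<in> carrier_mat n n"
    and row: "\<And>i. i < n \<Longrightarrow> (\<Sum>j<n. B $$ (i, j)) = r"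
    and w: "\<And>i. i < n \<Longrightarrow> (\<Sum>j<n. B $$ (i, j) * w j) = \<nu> * w i"
    and nonconst: "i < n" "j < n" "w i \<noteq> w j"
  shows "{#r, \<nu>#} \<subseteq># proots (char_poly B)"
proof -
  obtain m where m: "n = Suc m" using nonconst by (cases n) auto
  define B' where "B' = mat m m (\<lambda>(i, j). B $$ (Suc i, Suc j) - B $$ (0, Suc j))"
  have B': "B' \<in> carrier_mat m m" by (simp add: B'_def)
  define v where "v = vec m (\<lambda>i. w (Suc i) - w 0)"
  have "v \<noteq> 0\<^sub>v m"
  proof
    assume v: "v = 0\<^sub>v m"
    have "w k = w 0" if "k < n" for k
    proof (cases k)
      case (Suc k')
      then have "v $ k' = 0" using that m v by simp
      then show ?thesis using Suc that m by (simp add: v_def)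
    qed simp
    with nonconst show False by metis
  qed
  moreover have "B' *\<^sub>v v = \<nu> \<cdot>\<^sub>v v"
  proof (rule eq_vecI)
    fix k assume "k < dim_vec (\<nu> \<cdot>\<^sub>v v)"
    then have k: "k < m" by (simp add: v_def)
    have "(B' *\<^sub>v v) $ k = (\<Sum>j<m. (B $$ (Suc k, Suc j) - B $$ (0, Suc j)) * (w (Suc j) - w 0))"
      using k by (simp add: B'_def v_def scalar_prod_def lessThan_atLeast0)
    \<comment> \<open>The added term \<open>j = 0\<close> contains \<open>w 0 - w 0\<close>; with
      full rows, the contribution of \<open>w 0\<close> cancels because all row sums agree.\<close>
    also have "\<dots> = (\<Sum>j<n. (B $$ (Suc k, j) - B $$ (0, j)) * (w j - w 0))"
      by (simp add: m sum.lessThan_Suc_shift del: sum.lessThan_Suc)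
    also have "\<dots> = ((\<Sum>j<n. B $$ (Suc k, j) * w j) - (\<Sum>j<n. B $$ (0, j) * w j))
        - ((\<Sum>j<n. B $$ (Suc k, j)) - (\<Sum>j<n. B $$ (0, j))) * w 0"
      by (simp add: algebra_simps sum.distrib sum_subtractf sum_distrib_left sum_distrib_right)
    also have "\<dots> = \<nu> * (w (Suc k) - w 0)"
      using w[of "Suc k"] w[of 0] row[of "Suc k"] row[of 0] k m by (simp only: Suc_mono zero_less_Suc simp_thms) (simp add: right_diff_distrib)
    finally show "(B' *\<^sub>v v) $ k = (\<nu> \<cdot>\<^sub>v v) $ k" using k by (simp add: v_def)
  qed (simp add: B'_def v_def)
  ultimately have "eigenvalue B' \<nu>"
    using B' unfolding eigenvalue_def eigenvector_def
    by (intro exI[of _ v]) (simp add: v_def)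
  then have "poly (char_poly B') \<nu> = 0" using eigenvalue_root_char_poly[OF B'] by simp
  moreover have nz: "char_poly B' \<noteq> 0" using degree_monic_char_poly[OF B'] by auto
  ultimately have "\<nu> \<in># proots (char_poly B')" by simp
  moreover have "char_poly B = [:- r, 1:] * char_poly B'"
    unfolding B'_def using char_poly_constant_row_sums B row m by blast
  moreover have "proots ([:- r, 1:] * char_poly B') = {#r#} + proots (char_poly B')"
    using nz by (subst proots_mult) auto
  ultimately show ?thesis by simp
qed

text \<open>By counting: if entry 1 of the decreasing list were below \<open>b\<close>, only the
  head could reach \<open>b\<close>, yet \<open>a\<close> and \<open>b\<close> give two such
  elements with multiplicity.\<close>

lemma second_largest_ge:
  fixes S :: "real multiset"
  assumes "{#a, b#} \<subseteq># S" "b \<le> a"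
  shows "2 \<le> size S" and "b \<le> rev (sorted_list_of_multiset S) ! 1"
proof -
  have "size {#a, b#} \<le> size S" by (rule size_mset_mono) fact
  then show sz: "2 \<le> size S" by simp
  define xs where "xs = rev (sorted_list_of_multiset S)"
  have mxs: "mset xs = S" by (simp add: xs_def)
  have sorted: "sorted_wrt (\<ge>) xs" by (simp add: xs_def sorted_wrt_rev)
  have len: "length xs \<ge> 2" using sz mxs by (metis size_mset)
  then obtain x y zs where xs: "xs = x # y # zs"
    by (cases xs; cases "tl xs") auto
  have "b \<le> y"
  proof (rule ccontr)
    assume "\<not> b \<le> y"
    then have "filter_mset (\<lambda>z. z \<ge> b) (mset (y # zs)) = {#}"
      using sorted xs by auto
    then have "size (filter_mset (\<lambda>z. z \<ge> b) S) \<le> 1"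
      using mxs xs by auto
    moreover have "size (filter_mset (\<lambda>z. z \<ge> b) {#a, b#}) \<le> size (filter_mset (\<lambda>z. z \<ge> b) S)"
      by (intro size_mset_mono multiset_filter_mono assms)
    ultimately show False using assms(2) by simp
  qed
  then show "b \<le> rev (sorted_list_of_multiset S) ! 1"
    using xs by (simp add: xs_def[symmetric])
qed

section \<open>Maximising a quadratic form over the unit vectors of sum 0\<close>

text \<open>Vectors are functions on the whole type with the product topology. Vanishing off
  \<open>S\<close> puts them into a product of intervals and singletons, which is compact by
  Tychonoff's theorem; the other two conditions are closed.\<close>

lemma compact_centred_sphere:
  assumes "finite S"
  shows "compact {u :: 'a \<Rightarrow> real. (\<forall>x. x \<notin> S \<longrightarrow> u x = 0) \<and> (\<Sum>x\<in>S. u x) = 0 \<and> (\<Sum>x\<in>S. (u x)\<^sup>2) = 1}"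
    (is "compact ?U")
proof -
  define K :: "('a \<Rightarrow> real) set" where "K = (\<Pi>\<^sub>E x\<in>UNIV. if x \<in> S then {-1..1} else {0})"
  have "compactin (product_topology (\<lambda>_. euclidean) UNIV) K"
    unfolding K_def compactin_PiE by (auto simp: compactin_euclidean_iff)
  then have "compact K" by (simp add: euclidean_product_topology compactin_euclidean_iff)
  moreover have "closed {u :: 'a \<Rightarrow> real. (\<Sum>x\<in>S. u x) = 0}" "closed {u :: 'a \<Rightarrow> real. (\<Sum>x\<in>S. (u x)\<^sup>2) = 1}"
    by (intro closed_Collect_eq continuous_intros continuous_on_product_coordinates)+
  ultimately have "compact (K \<inter> {u. (\<Sum>x\<in>S. u x) = 0} \<inter> {u. (\<Sum>x\<in>S. (u x)\<^sup>2) = 1})"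
    by (intro compact_Int_closed)
  also have "K \<inter> {u. (\<Sum>x\<in>S. u x) = 0} \<inter> {u. (\<Sum>x\<in>S. (u x)\<^sup>2) = 1} = ?U"
  proof (intro equalityI subsetI)
    fix u assume u: "u \<in> ?U"
    have "\<bar>u x\<bar> \<le> 1" if "x \<in> S" for x
    proof -
      have "(u x)\<^sup>2 \<le> (\<Sum>x\<in>S. (u x)\<^sup>2)"
        using assms that by (intro member_le_sum) auto
      then show ?thesis using u by (simp add: abs_square_le_1)
    qed
    then show "u \<in> K \<inter> {u. (\<Sum>x\<in>S. u x) = 0} \<inter> {u. (\<Sum>x\<in>S. (u x)\<^sup>2) = 1}"
      using u by (auto simp: K_def abs_le_iff)
  qed (auto simp: K_def PiE_iff split: if_splits)
  finally show ?thesis .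
qed

text \<open>The Rayleigh quotient argument on the space of vectors of sum 0, which a symmetric
  matrix with constant row sums preserves. Two points in \<open>S\<close> make the unit sphere of
  that space nonempty.\<close>

lemma top_centred_eigenvector:
  fixes K :: "'a \<Rightarrow> 'a \<Rightarrow> real"
  assumes fin: "finite S" and card: "2 \<le> card S"
    and sym: "\<And>x y. x \<in> S \<Longrightarrow> y \<in> S \<Longrightarrow> K x y = K y x"
    and row: "\<And>x. x \<in> S \<Longrightarrow> (\<Sum>y\<in>S. K x y) = r"
  obtains \<nu> w where "(\<Sum>x\<in>S. w x) = 0" "(\<Sum>x\<in>S. (w x)\<^sup>2) = 1"
    "\<And>x. x \<in> S \<Longrightarrow> (\<Sum>y\<in>S. K x y * w y) = \<nu> * w x"
    "\<And>u. (\<Sum>x\<in>S. u x) = 0 \<Longrightarrow> (\<Sum>x\<in>S. \<Sum>y\<in>S. K x y * (u x * u y)) \<le> \<nu> * (\<Sum>x\<in>S. (u x)\<^sup>2)"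
proof -
  define U :: "('a \<Rightarrow> real) set" where
    "U = {u. (\<forall>x. x \<notin> S \<longrightarrow> u x = 0) \<and> (\<Sum>x\<in>S. u x) = 0 \<and> (\<Sum>x\<in>S. (u x)\<^sup>2) = 1}"
  define b where "b u v = (\<Sum>x\<in>S. \<Sum>y\<in>S. K x y * (u x * v y))" for u v :: "'a \<Rightarrow> real"
  obtain a c where ac: "a \<in> S" "c \<in> S" "a \<noteq> c"
    using card by (metis card_le_Suc0_iff_eq fin not_less_eq_eq numeral_2_eq_2)
  define u0 where "u0 x = (if x = a then 1 / sqrt 2 else 0) - (if x = c then 1 / sqrt 2 else 0)" for x
  have sq: "(u0 x)\<^sup>2 = (if x = a then 1 / 2 else 0) + (if x = c then 1 / 2 else 0)" for x
    using ac by (auto simp: u0_def power_divide)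
  have "u0 \<in> U"
  proof -
    have "(\<Sum>x\<in>S. u0 x) = 0" using ac fin by (simp add: u0_def sum_subtractf)
    moreover have "u0 x = 0" if "x \<notin> S" for x using that ac by (auto simp: u0_def)
    moreover have "(\<Sum>x\<in>S. (u0 x)\<^sup>2) = 1" using ac fin by (simp add: sq sum.distrib)
    ultimately show ?thesis by (simp add: U_def)
  qed
  moreover have "compact U" unfolding U_def by (rule compact_centred_sphere[OF fin])
  moreover have "continuous_on U (\<lambda>u. b u u)"
    unfolding b_def
    by (intro continuous_intros continuous_on_subset[OF continuous_on_product_coordinates]) auto
  ultimately obtain w where w: "w \<in> U" and max: "\<And>u. u \<in> U \<Longrightarrow> b u u \<le> b w w"
    using continuous_attains_sup[of U "\<lambda>u. b u u"] by auto
  define \<nu> where "\<nu> = b w w"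
  define p where "p u = (\<Sum>x\<in>S. (u x)\<^sup>2)" for u :: "'a \<Rightarrow> real"
  \<comment> \<open>Homogeneity extends the maximum from the sphere; \<open>u\<close> is scaled and
    cut off outside \<open>S\<close> to land in \<open>U\<close>.\<close>
  have bound: "b u u \<le> \<nu> * p u" if u: "(\<Sum>x\<in>S. u x) = 0" for u
  proof (cases "p u = 0")
    case True
    then have "\<forall>x\<in>S. u x = 0" using fin by (simp add: p_def sum_nonneg_eq_0_iff)
    then show ?thesis using True by (simp add: b_def)
  next
    case False
    then have pos: "p u > 0" by (simp add: p_def sum_nonneg order_less_le)
    define v where "v x = (if x \<in> S then u x / sqrt (p u) else 0)" for x
    have "(\<Sum>x\<in>S. (v x)\<^sup>2) = p u / p u"
      using pos by (simp add: v_def power_divide p_def flip: sum_divide_distrib)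
    moreover have "(\<Sum>x\<in>S. v x) = 0"
      using u by (simp add: v_def flip: sum_divide_distrib)
    ultimately have "v \<in> U" using pos by (simp add: U_def v_def)
    moreover have "b v v = b u u / p u"
      using pos by (simp add: b_def v_def sum_divide_distrib)
    ultimately have "b u u / p u \<le> \<nu>" using max \<nu>_def by metis
    then show ?thesis using pos by (simp add: divide_le_eq)
  qed
  have w0: "(\<Sum>x\<in>S. w x) = 0" and w1: "p w = 1" using w by (auto simp: U_def p_def)
  \<comment> \<open>Perturbing the maximiser \<open>w\<close> in the direction of its residual \<open>z\<close> shows that \<open>z\<close> vanishes.\<close>
  define z where "z x = \<nu> * w x - (\<Sum>y\<in>S. K x y * w y)" for x
  \<comment> \<open>Column sums equal row sums by symmetry, so the image of \<open>w\<close> has sum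
    0 and so does \<open>z\<close>; the perturbed vectors remain admissible.\<close>
  have "(\<Sum>x\<in>S. \<Sum>y\<in>S. K x y * w y) = (\<Sum>y\<in>S. w y * (\<Sum>x\<in>S. K y x))"
    by (subst sum.swap) (auto intro!: sum.cong simp: sum_distrib_left sym mult.commute)
  also have "\<dots> = 0"
    using w0 by (simp add: row flip: sum_distrib_right)
  finally have z0: "(\<Sum>x\<in>S. z x) = 0"
    using w0 by (simp add: z_def sum_subtractf flip: sum_distrib_left)
  have bsym: "b w z = b z w"
    unfolding b_def by (subst sum.swap) (auto intro!: sum.cong simp: sym mult_ac)
  have pz: "p z = \<nu> * (\<Sum>x\<in>S. w x * z x) - b z w"
  proof -
    have "(z x)\<^sup>2 = \<nu> * (w x * z x) - (\<Sum>y\<in>S. K x y * (z x * w y))" for x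
    proof -
      have "(z x)\<^sup>2 = z x * (\<nu> * w x - (\<Sum>y\<in>S. K x y * w y))"
        by (simp add: power2_eq_square flip: z_def)
      then show ?thesis by (simp add: right_diff_distrib sum_distrib_left mult_ac)
    qed
    then show ?thesis by (simp add: p_def b_def sum_subtractf sum_distrib_left)
  qed
  \<comment> \<open>This is \<open>bound\<close> at \<open>w + t * z\<close>: the constant terms
    cancel, and by \<open>pz\<close> the linear coefficient is twice the squared norm of
    \<open>z\<close>.\<close>
  have quad: "0 \<le> 2 * t * p z + t\<^sup>2 * (\<nu> * p z - b z z)" for t
  proof -
    have "b (\<lambda>x. w x + t * z x) (\<lambda>x. w x + t * z x) = b w w + t * b w z + t * b z w + t\<^sup>2 * b z z"
      by (simp add: b_def power2_eq_square sum.distrib sum_distrib_left algebra_simps)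
    moreover have "p (\<lambda>x. w x + t * z x) = p w + 2 * t * (\<Sum>x\<in>S. w x * z x) + t\<^sup>2 * p z"
      by (simp add: p_def power2_eq_square sum.distrib sum_distrib_left algebra_simps)
    moreover have "b (\<lambda>x. w x + t * z x) (\<lambda>x. w x + t * z x) \<le> \<nu> * p (\<lambda>x. w x + t * z x)"
      by (rule bound) (simp add: sum.distrib w0 z0 flip: sum_distrib_left)
    ultimately have "\<nu> + t * b z w + t * b z w + t\<^sup>2 * b z z
        \<le> \<nu> * (1 + 2 * t * (\<Sum>x\<in>S. w x * z x) + t\<^sup>2 * p z)"
      by (simp only: bsym w1 \<nu>_def)
    moreover have "b z w = \<nu> * (\<Sum>x\<in>S. w x * z x) - p z" using pz by simp
    ultimately show ?thesis by (simp add: algebra_simps)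
  qed
  have "p z = 0"
  proof (rule ccontr)
    assume "p z \<noteq> 0"
    then have pos: "p z > 0" by (simp add: p_def sum_nonneg order_less_le)
    \<comment> \<open>For small negative \<open>t\<close> the linear term dominates;
      \<open>t = - (p z / D)\<close> makes the expression at most
      \<open>- (p z)\<^sup>2 / D\<close>.\<close>
    define C where "C = \<nu> * p z - b z z"
    define D where "D = \<bar>C\<bar> + 1"
    have D: "D > 0" "C \<le> D" by (auto simp: D_def)
    have "0 \<le> 2 * (- (p z / D)) * p z + (- (p z / D))\<^sup>2 * C"
      using quad[of "- (p z / D)"] by (simp add: C_def)
    also have "\<dots> \<le> 2 * (- (p z / D)) * p z + (- (p z / D))\<^sup>2 * D"
      using D by (intro add_left_mono mult_left_mono) auto
    also have "\<dots> = - ((p z)\<^sup>2 / D)"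
      using D by (simp add: power2_eq_square field_simps)
    also have "\<dots> < 0" using pos D by simp
    finally show False by simp
  qed
  then have "\<forall>x\<in>S. z x = 0" using fin by (simp add: p_def sum_nonneg_eq_0_iff)
  then show thesis
    using w0 w1 bound that[of w \<nu>] by (simp add: z_def b_def p_def)
qed

section \<open>Spectral expanders\<close>

context
  fixes M :: "('y, 'x) bigraph" and d :: nat
  assumes bigraph: "is_bigraph M" and regular: "inner_regular d M"
begin

lemma finite_classes: "finite (inner M)" "finite (outer M)"
  using bigraph by (auto simp: is_bigraph_def)

lemma nbrs_of_inner_subset: "nbrs_of_inner M x \<subseteq> outer M"
  using bigraph by (auto simp: is_bigraph_def nbrs_of_inner_def)

lemma nbrs_of_outer_subset: "nbrs_of_outer M x' \<subseteq> inner M"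
  using bigraph by (auto simp: is_bigraph_def nbrs_of_outer_def)

lemma degree_pos: "d > 0"
  using regular by (simp add: inner_regular_def)

lemma card_nbrs_of_inner: "x \<in> inner M \<Longrightarrow> card (nbrs_of_inner M x) = d"
  using regular by (simp add: inner_regular_def)

lemma card_nbrs_of_outer_pos:
  assumes "x' \<in> nbrs_of_inner M x"
  shows "card (nbrs_of_outer M x') > 0"
  using assms finite_subset[OF nbrs_of_outer_subset finite_classes(1)]
  by (auto simp: card_gt_0_iff nbrs_of_inner_def nbrs_of_outer_def)

text \<open>The factor \<open>card (inner M)\<close> cancels, leaving the inverse root of the
  product of the two endpoint degrees.\<close>

lemma norm_adj_entry_altdef:
  assumes "x \<in> inner M"
  shows "norm_adj_entry d M x x' =
    (if x' \<in> nbrs_of_inner M x then 1 / sqrt (real d * real (card (nbrs_of_outer M x'))) else 0)"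
proof (cases "x' \<in> nbrs_of_inner M x")
  case True
  have "card (inner M) > 0" using assms finite_classes by (auto simp: card_gt_0_iff)
  then show ?thesis
    using True degree_pos card_nbrs_of_outer_pos[OF True]
    by (simp add: norm_adj_entry_def mu_inner_def mu_outer_def real_sqrt_divide real_sqrt_mult field_simps)
qed (simp add: norm_adj_entry_def)

lemma sum_over_edges:
  "(\<Sum>x\<in>inner M. \<Sum>x'\<in>nbrs_of_inner M x. h x x') = (\<Sum>x'\<in>outer M. \<Sum>x\<in>nbrs_of_outer M x'. h x x')"
proof -
  have fin: "finite (nbrs_of_inner M x)" "finite (nbrs_of_outer M x')" for x x'
    using finite_subset[OF nbrs_of_inner_subset] finite_subset[OF nbrs_of_outer_subset] finite_classes by auto
  have "(\<Sum>x\<in>inner M. \<Sum>x'\<in>nbrs_of_inner M x. h x x') =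
      sum (\<lambda>(x, x'). h x x') (Sigma (inner M) (nbrs_of_inner M))"
    using finite_classes fin by (simp add: sum.Sigma)
  also have "\<dots> = sum (\<lambda>(x', x). h x x') (Sigma (outer M) (nbrs_of_outer M))"
    by (rule sum.reindex_bij_witness[of _ prod.swap prod.swap])
       (use bigraph in \<open>auto simp: nbrs_of_inner_def nbrs_of_outer_def is_bigraph_def\<close>)
  also have "\<dots> = (\<Sum>x'\<in>outer M. \<Sum>x\<in>nbrs_of_outer M x'. h x x')"
    using finite_classes fin by (simp add: sum.Sigma)
  finally show ?thesis .
qed

section \<open>The Gram matrix of the normalised adjacency matrix\<close>

text \<open>On inner vertices this is the transition matrix of the two-step walk through a random
  neighbour and back, indexed by vertices instead of their enumeration.\<close>

definition gram :: "'x \<Rightarrow> 'x \<Rightarrow> real" where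
  "gram x y = (\<Sum>x'\<in>outer M. norm_adj_entry d M x x' * norm_adj_entry d M y x')"

lemma gram_nonneg: "x \<in> inner M \<Longrightarrow> y \<in> inner M \<Longrightarrow> 0 \<le> gram x y"
  by (auto simp: gram_def norm_adj_entry_altdef intro!: sum_nonneg)

text \<open>Each neighbour of \<open>x\<close> contributes \<open>1 / d\<close>, as its column sum
  cancels the root of its degree, and there are \<open>d\<close> neighbours.\<close>

lemma gram_row_sum:
  assumes x: "x \<in> inner M"
  shows "(\<Sum>y\<in>inner M. gram x y) = 1"
proof -
  have col: "(\<Sum>y\<in>inner M. norm_adj_entry d M y x') =
      real (card (nbrs_of_outer M x')) / sqrt (real d * real (card (nbrs_of_outer M x')))" for x'
  proof -
    have "(\<Sum>y\<in>inner M. norm_adj_entry d M y x') =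
        (\<Sum>y\<in>inner M. if y \<in> nbrs_of_outer M x' then 1 / sqrt (real d * real (card (nbrs_of_outer M x'))) else 0)"
      by (intro sum.cong) (auto simp: norm_adj_entry_altdef nbrs_of_inner_def nbrs_of_outer_def)
    also have "inner M \<inter> nbrs_of_outer M x' = nbrs_of_outer M x'"
      using nbrs_of_outer_subset by blast
    then have "(\<Sum>y\<in>inner M. if y \<in> nbrs_of_outer M x' then 1 / sqrt (real d * real (card (nbrs_of_outer M x'))) else 0)
       = real (card (nbrs_of_outer M x')) / sqrt (real d * real (card (nbrs_of_outer M x')))"
      using finite_classes by (simp flip: sum.inter_restrict)
    finally show ?thesis .
  qed
  have "(\<Sum>y\<in>inner M. gram x y) =
      (\<Sum>x'\<in>outer M. norm_adj_entry d M x x' * (\<Sum>y\<in>inner M. norm_adj_entry d M y x'))"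
    unfolding gram_def by (subst sum.swap) (simp add: sum_distrib_left)
  also have "\<dots> = (\<Sum>x'\<in>outer M. if x' \<in> nbrs_of_inner M x then 1 / real d else 0)"
  proof (rule sum.cong)
    fix x' assume "x' \<in> outer M"
    show "norm_adj_entry d M x x' * (\<Sum>y\<in>inner M. norm_adj_entry d M y x') =
        (if x' \<in> nbrs_of_inner M x then 1 / real d else 0)"
      using card_nbrs_of_outer_pos[of x' x] degree_pos
      by (auto simp: col norm_adj_entry_altdef[OF x])
  qed simp
  also have "outer M \<inter> nbrs_of_inner M x = nbrs_of_inner M x"
    using nbrs_of_inner_subset by blast
  then have "(\<Sum>x'\<in>outer M. if x' \<in> nbrs_of_inner M x then 1 / real d else 0) = 1"
    using finite_classes card_nbrs_of_inner[OF x] degree_pos by (simp flip: sum.inter_restrict)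
  finally show ?thesis .
qed

lemma gram_quadratic_form:
  "(\<Sum>x\<in>inner M. \<Sum>y\<in>inner M. gram x y * (u x * u y)) =
    (\<Sum>x'\<in>outer M. (\<Sum>x\<in>inner M. norm_adj_entry d M x x' * u x)\<^sup>2)"
proof -
  have "(\<Sum>x\<in>inner M. \<Sum>y\<in>inner M. gram x y * (u x * u y)) =
      (\<Sum>x\<in>inner M. \<Sum>y\<in>inner M. \<Sum>x'\<in>outer M. (norm_adj_entry d M x x' * u x) * (norm_adj_entry d M y x' * u y))"
    by (simp add: gram_def sum_distrib_left sum_distrib_right mult_ac)
  also have "\<dots> = (\<Sum>x\<in>inner M. \<Sum>x'\<in>outer M. \<Sum>y\<in>inner M. (norm_adj_entry d M x x' * u x) * (norm_adj_entry d M y x' * u y))"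
    by (intro sum.cong refl sum.swap)
  also have "\<dots> = (\<Sum>x'\<in>outer M. \<Sum>x\<in>inner M. \<Sum>y\<in>inner M. (norm_adj_entry d M x x' * u x) * (norm_adj_entry d M y x' * u y))"
    by (rule sum.swap)
  finally show ?thesis by (simp add: power2_eq_square sum_product)
qed

text \<open>The inequality of arithmetic and geometric means, weighted by a nonnegative symmetric
  matrix with row sums 1. It yields \<open>\<nu> \<le> 1\<close>.\<close>

lemma gram_le_identity:
  "(\<Sum>x\<in>inner M. \<Sum>y\<in>inner M. gram x y * (u x * u y)) \<le> (\<Sum>x\<in>inner M. (u x)\<^sup>2)"
proof -
  have sym: "gram x y = gram y x" for x y by (simp add: gram_def mult.commute)
  have "(\<Sum>x\<in>inner M. \<Sum>y\<in>inner M. gram x y * (u x * u y)) \<le>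
      (\<Sum>x\<in>inner M. \<Sum>y\<in>inner M. gram x y * (((u x)\<^sup>2 + (u y)\<^sup>2) / 2))"
  proof (intro sum_mono mult_left_mono)
    fix x y
    have "0 \<le> (u x - u y)\<^sup>2" by simp
    then show "u x * u y \<le> ((u x)\<^sup>2 + (u y)\<^sup>2) / 2" by (simp add: power2_diff)
  qed (rule gram_nonneg)
  also have "\<dots> = (\<Sum>x\<in>inner M. \<Sum>y\<in>inner M. gram x y * (u x)\<^sup>2) / 2
      + (\<Sum>x\<in>inner M. \<Sum>y\<in>inner M. gram x y * (u y)\<^sup>2) / 2"
    by (simp add: sum.distrib algebra_simps add_divide_distrib sum_divide_distrib)
  also have "(\<Sum>x\<in>inner M. \<Sum>y\<in>inner M. gram x y * (u y)\<^sup>2) = (\<Sum>x\<in>inner M. \<Sum>y\<in>inner M. gram x y * (u x)\<^sup>2)"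
    by (subst sum.swap) (simp add: sym)
  also have "(\<Sum>x\<in>inner M. \<Sum>y\<in>inner M. gram x y * (u x)\<^sup>2) = (\<Sum>x\<in>inner M. (u x)\<^sup>2)"
    by (simp add: gram_row_sum flip: sum_distrib_right)
  finally show ?thesis by simp
qed

text \<open>The top eigenvalue \<open>\<nu>\<close> on centred vectors bounds the quadratic form
  there. Together with the eigenvalue 1 it occurs among the roots of the characteristic polynomial,
  so \<open>sqrt \<nu>\<close> is at most the second singular value.\<close>

lemma second_singular_value_bound:
  assumes card: "2 \<le> card (inner M)"
  shows "0 \<le> second_singular_value (norm_adj d M)"
    and "(\<Sum>x\<in>inner M. u x) = 0 \<Longrightarrow>
      (\<Sum>x'\<in>outer M. (\<Sum>x\<in>inner M. norm_adj_entry d M x x' * u x)\<^sup>2)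
        \<le> (second_singular_value (norm_adj d M))\<^sup>2 * (\<Sum>x\<in>inner M. (u x)\<^sup>2)"
proof -
  let ?\<sigma> = "second_singular_value (norm_adj d M)"
  obtain \<nu> w where w: "(\<Sum>x\<in>inner M. w x) = 0" "(\<Sum>x\<in>inner M. (w x)\<^sup>2) = 1"
      "\<And>x. x \<in> inner M \<Longrightarrow> (\<Sum>y\<in>inner M. gram x y * w y) = \<nu> * w x"
      "\<And>u. (\<Sum>x\<in>inner M. u x) = 0 \<Longrightarrow>
         (\<Sum>x\<in>inner M. \<Sum>y\<in>inner M. gram x y * (u x * u y)) \<le> \<nu> * (\<Sum>x\<in>inner M. (u x)\<^sup>2)"
    by (rule top_centred_eigenvector[of "inner M" gram 1])
      (use finite_classes card gram_row_sum in \<open>auto simp: gram_def mult.commute\<close>)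
  \<comment> \<open>As \<open>w\<close> is a unit eigenvector, \<open>\<nu>\<close> is the value of
    the form at \<open>w\<close>, which lies between 0 and 1.\<close>
  have "(\<Sum>x\<in>inner M. \<Sum>y\<in>inner M. gram x y * (w x * w y)) = (\<Sum>x\<in>inner M. w x * (\<Sum>y\<in>inner M. gram x y * w y))"
    by (simp add: sum_distrib_left mult_ac)
  also have "\<dots> = (\<Sum>x\<in>inner M. w x * (\<nu> * w x))"
    by (intro sum.cong) (simp_all add: w)
  also have "\<dots> = \<nu> * (\<Sum>x\<in>inner M. (w x)\<^sup>2)"
    by (simp add: sum_distrib_left power2_eq_square mult_ac)
  finally have \<nu>: "\<nu> = (\<Sum>x\<in>inner M. \<Sum>y\<in>inner M. gram x y * (w x * w y))"
    using w by simp
  then have \<nu>0: "0 \<le> \<nu>" by (simp add: gram_quadratic_form sum_nonneg)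
  have \<nu>1: "\<nu> \<le> 1" using \<nu> gram_le_identity[of w] w by simp
  define n where "n = card (inner M)"
  define e where "e = from_nat_into (inner M)"
  have e: "bij_betw e {..<n} (inner M)" "bij_betw (from_nat_into (outer M)) {..<card (outer M)} (outer M)"
    unfolding e_def n_def using bij_betw_from_nat_into_finite finite_classes by auto
  then have e_in: "e i \<in> inner M" if "i < n" for i
    using that by (auto simp: bij_betw_def)
  define B where "B = norm_adj d M * transpose_mat (norm_adj d M)"
  have B: "B \<in> carrier_mat n n" unfolding B_def norm_adj_def n_def by (rule mult_carrier_mat[OF mat_carrier]) simp
  have entry: "B $$ (i, j) = gram (e i) (e j)" if "i < n" "j < n" for i j
  proof -
    have "B $$ (i, j) = (\<Sum>k<card (outer M). norm_adj_entry d M (e i) (from_nat_into (outer M) k)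
        * norm_adj_entry d M (e j) (from_nat_into (outer M) k))"
      using that by (simp add: B_def norm_adj_def n_def e_def scalar_prod_def lessThan_atLeast0)
    also have "\<dots> = gram (e i) (e j)"
      unfolding gram_def by (rule sum.reindex_bij_betw[OF e(2)])
    finally show ?thesis .
  qed
  have reindex: "(\<Sum>j<n. g (e j)) = (\<Sum>y\<in>inner M. g y)" for g :: "'x \<Rightarrow> real"
    by (rule sum.reindex_bij_betw[OF e(1)])
  \<comment> \<open>A constant vector of sum 0 would vanish and could not have norm 1.\<close>
  have "\<exists>i j. i < n \<and> j < n \<and> w (e i) \<noteq> w (e j)"
  proof (rule ccontr)
    assume "\<not> ?thesis"
    moreover have "0 < n" using card by (simp add: n_def)
    ultimately have const: "w (e i) = w (e 0)" if "i < n" for i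
      using that by blast
    have "(\<Sum>j<n. w (e j)) = (\<Sum>j<n. w (e 0))"
      by (intro sum.cong[OF refl] const) simp
    then have "w (e 0) = 0" using reindex[of w] w(1) \<open>0 < n\<close> by simp
    then have "w (e i) = 0" if "i < n" for i using const[OF that] by simp
    then have "(\<Sum>j<n. (w (e j))\<^sup>2) = 0" by simp
    then show False using reindex[of "\<lambda>x. (w x)\<^sup>2"] w(2) by simp
  qed
  then obtain i j where ij: "i < n" "j < n" "w (e i) \<noteq> w (e j)" by blast
  have "{#1, \<nu>#} \<subseteq># proots (char_poly B)"
  proof (rule proots_constant_row_sums[OF B, where w = "\<lambda>i. w (e i)"])
    fix i assume i: "i < n"
    show "(\<Sum>j<n. B $$ (i, j)) = 1"
      using i reindex[of "gram (e i)"] gram_row_sum[OF e_in[OF i]] by (simp add: entry)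
    show "(\<Sum>j<n. B $$ (i, j) * w (e j)) = \<nu> * w (e i)"
      using i reindex[of "\<lambda>y. gram (e i) y * w y"] w(3)[OF e_in[OF i]] by (simp add: entry)
  qed (use ij in auto)
  then have sub: "{#1, sqrt \<nu>#} \<subseteq># image_mset sqrt (proots (char_poly B))"
    using image_mset_subseteq_mono[of "{#1, \<nu>#}" _ sqrt] by simp
  \<comment> \<open>Without \<open>\<nu> \<le> 1\<close>, the second largest of the singular values could be the trivial one.\<close>
  have "sqrt \<nu> \<le> 1" using \<nu>1 by simp
  note second_largest_ge[OF sub this]
  then have le: "sqrt \<nu> \<le> ?\<sigma>"
    by (simp add: second_singular_value_def singular_values_def B_def[symmetric] flip: size_mset)
  then show "0 \<le> ?\<sigma>" using \<nu>0 by (smt (verit) real_sqrt_ge_zero)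
  assume u: "(\<Sum>x\<in>inner M. u x) = 0"
  have "\<nu> \<le> ?\<sigma>\<^sup>2"
    using le \<nu>0 by (metis power_mono real_sqrt_ge_zero real_sqrt_pow2)
  then have "\<nu> * (\<Sum>x\<in>inner M. (u x)\<^sup>2) \<le> ?\<sigma>\<^sup>2 * (\<Sum>x\<in>inner M. (u x)\<^sup>2)"
    by (intro mult_right_mono sum_nonneg) auto
  then show "(\<Sum>x'\<in>outer M. (\<Sum>x\<in>inner M. norm_adj_entry d M x x' * u x)\<^sup>2) \<le> ?\<sigma>\<^sup>2 * (\<Sum>x\<in>inner M. (u x)\<^sup>2)"
    using w(4)[OF u] by (simp add: gram_quadratic_form)
qed

section \<open>Deviation of neighbourhood averages from their mean\<close>

text \<open>The sum \<open>T\<close> of squared deviations is an inner product of the centred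
  \<open>s\<close>, weighted by degrees, with the transposed adjacency matrix applied to
  \<open>h\<close>. Cauchy-Schwarz and the spectral bound give
  \<open>T\<^sup>2 \<le> n / 4 * (\<sigma>\<^sup>2 * T)\<close>, and a second use of Cauchy-Schwarz
  passes to absolute values.\<close>

lemma deviation_le_second_singular_value:
  fixes s :: "'y \<Rightarrow> real"
  defines "f \<equiv> \<lambda>x. (\<Sum>x'\<in>nbrs_of_inner M x. s x') / real d"
  defines "c \<equiv> (\<Sum>x\<in>inner M. f x) / real (card (inner M))"
  assumes card: "2 \<le> card (inner M)"
    and s: "\<And>x'. x' \<in> outer M \<Longrightarrow> 0 \<le> s x' \<and> s x' \<le> 1"
  shows "(\<Sum>x\<in>inner M. \<bar>f x - c\<bar>) \<le> real (card (inner M)) * second_singular_value (norm_adj d M) / 2"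
proof -
  let ?\<sigma> = "second_singular_value (norm_adj d M)"
  define n where "n = real (card (inner M))"
  define h where "h x = f x - c" for x
  \<comment> \<open>This is \<open>n\<close> times \<open>mu_outer\<close>: the weight of
    \<open>x'\<close> as a random neighbour of an inner vertex, of total mass
    \<open>n\<close>.\<close>
  define D where "D x' = real (card (nbrs_of_outer M x')) / real d" for x'
  define T where "T = (\<Sum>x\<in>inner M. (h x)\<^sup>2)"
  have n: "n \<ge> 2" using card by (simp add: n_def)
  have \<sigma>: "0 \<le> ?\<sigma>" by (rule second_singular_value_bound[OF card])
  have f_alt: "f x - a = (\<Sum>x'\<in>nbrs_of_inner M x. (s x' - a) / real d)" if "x \<in> inner M" for x a
    using that degree_pos card_nbrs_of_inner[OF that]
    by (simp add: f_def sum_subtractf diff_divide_distrib flip: sum_divide_distrib)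
  have push: "(\<Sum>x\<in>inner M. \<Sum>x'\<in>nbrs_of_inner M x. g x' / real d) = (\<Sum>x'\<in>outer M. D x' * g x')" for g
    by (subst sum_over_edges) (simp add: D_def)
  have sumD: "(\<Sum>x'\<in>outer M. D x') = n"
    using push[of "\<lambda>_. 1"] degree_pos by (simp add: card_nbrs_of_inner n_def)
  have sumDs: "(\<Sum>x'\<in>outer M. D x' * s x') = n * c"
  proof -
    have "(\<Sum>x\<in>inner M. f x) = (\<Sum>x'\<in>outer M. D x' * s x')"
      using push[of s] by (simp add: f_def sum_divide_distrib)
    then show ?thesis using n by (simp add: c_def n_def)
  qed
  have h0: "(\<Sum>x\<in>inner M. h x) = 0"
    using n by (simp add: h_def sum_subtractf c_def n_def)
  \<comment> \<open>The variance of a \<open>[0, 1]\<close>-valued function is at most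
    \<open>1 / 4\<close>: bound the square of \<open>s\<close> by \<open>s\<close>, then complete
    the square in \<open>c\<close>.\<close>
  have var: "(\<Sum>x'\<in>outer M. D x' * (s x' - c)\<^sup>2) \<le> n / 4"
  proof -
    have "(\<Sum>x'\<in>outer M. D x' * (s x' - c)\<^sup>2) \<le> (\<Sum>x'\<in>outer M. D x' * (s x' - 2 * c * s x' + c\<^sup>2))"
    proof (intro sum_mono mult_left_mono)
      fix x' assume "x' \<in> outer M"
      then have "s x' * s x' \<le> s x' * 1" using s by (intro mult_left_mono) auto
      then show "(s x' - c)\<^sup>2 \<le> s x' - 2 * c * s x' + c\<^sup>2"
        by (simp add: power2_eq_square algebra_simps)
    qed (simp add: D_def)
    also have "\<dots> = (\<Sum>x'\<in>outer M. D x' * s x') * (1 - 2 * c) + (\<Sum>x'\<in>outer M. D x') * c\<^sup>2"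
      by (simp add: sum_distrib_right sum_distrib_left flip: sum.distrib) (simp add: algebra_simps)
    also have "\<dots> = n / 4 - n * (c - 1 / 2)\<^sup>2"
      unfolding sumD sumDs by (simp add: power2_eq_square algebra_simps)
    also have "\<dots> \<le> n / 4" using n by simp
    finally show ?thesis .
  qed
  have "T = (\<Sum>x\<in>inner M. \<Sum>x'\<in>nbrs_of_inner M x. h x * ((s x' - c) / real d))"
    unfolding T_def
    by (intro sum.cong refl) (simp add: h_def power2_eq_square f_alt sum_distrib_left)
  also have "\<dots> = (\<Sum>x\<in>inner M. \<Sum>x'\<in>outer M.
      sqrt (D x') * (s x' - c) * (norm_adj_entry d M x x' * h x))"
  proof (rule sum.cong[OF refl])
    fix x assume x: "x \<in> inner M"
    \<comment> \<open>The weight \<open>1 / d\<close> of an edge splits into the root of the vertex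
      weight and the matrix entry, which prepares Cauchy-Schwarz.\<close>
    have entry: "1 / real d = sqrt (D x') * norm_adj_entry d M x x'" if "x' \<in> nbrs_of_inner M x" for x'
      using that degree_pos card_nbrs_of_outer_pos[OF that]
      by (simp add: norm_adj_entry_altdef[OF x] D_def real_sqrt_divide real_sqrt_mult)
    have "(\<Sum>x'\<in>nbrs_of_inner M x. h x * ((s x' - c) / real d)) =
        (\<Sum>x'\<in>nbrs_of_inner M x. sqrt (D x') * (s x' - c) * (norm_adj_entry d M x x' * h x))"
    proof (rule sum.cong[OF refl])
      fix x' assume x': "x' \<in> nbrs_of_inner M x"
      have "h x * ((s x' - c) / real d) = h x * (s x' - c) * (1 / real d)" by simp
      then show "h x * ((s x' - c) / real d) = sqrt (D x') * (s x' - c) * (norm_adj_entry d M x x' * h x)"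
        unfolding entry[OF x'] by (simp add: mult_ac)
    qed
    also have "\<dots> = (\<Sum>x'\<in>outer M. sqrt (D x') * (s x' - c) * (norm_adj_entry d M x x' * h x))"
      using nbrs_of_inner_subset finite_classes
      by (intro sum.mono_neutral_left) (auto simp: norm_adj_entry_def)
    finally show "(\<Sum>x'\<in>nbrs_of_inner M x. h x * ((s x' - c) / real d)) =
        (\<Sum>x'\<in>outer M. sqrt (D x') * (s x' - c) * (norm_adj_entry d M x x' * h x))" .
  qed
  also have "\<dots> = (\<Sum>x'\<in>outer M. sqrt (D x') * (s x' - c) * (\<Sum>x\<in>inner M. norm_adj_entry d M x x' * h x))"
    by (subst sum.swap) (simp add: sum_distrib_left)
  finally have T: "T = (\<Sum>x'\<in>outer M. sqrt (D x') * (s x' - c) * (\<Sum>x\<in>inner M. norm_adj_entry d M x x' * h x))" .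
  have T0: "0 \<le> T" by (simp add: T_def sum_nonneg)
  have "T\<^sup>2 \<le> (\<Sum>x'\<in>outer M. (sqrt (D x') * (s x' - c))\<^sup>2)
      * (\<Sum>x'\<in>outer M. (\<Sum>x\<in>inner M. norm_adj_entry d M x x' * h x)\<^sup>2)"
    unfolding T by (rule Cauchy_Schwarz_ineq_sum)
  also have "(\<Sum>x'\<in>outer M. (sqrt (D x') * (s x' - c))\<^sup>2) = (\<Sum>x'\<in>outer M. D x' * (s x' - c)\<^sup>2)"
    by (simp add: power_mult_distrib D_def)
  also have "\<dots> * (\<Sum>x'\<in>outer M. (\<Sum>x\<in>inner M. norm_adj_entry d M x x' * h x)\<^sup>2) \<le> n / 4 * (?\<sigma>\<^sup>2 * T)"
    unfolding T_def using n
    by (intro mult_mono var second_singular_value_bound[OF card] h0 sum_nonneg) auto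
  finally have "T * T \<le> n * ?\<sigma>\<^sup>2 / 4 * T"
    by (simp add: power2_eq_square mult_ac)
  then have T_le: "T \<le> n * ?\<sigma>\<^sup>2 / 4"
    using T0 n by (cases "T = 0") auto
  have "(\<Sum>x\<in>inner M. \<bar>h x\<bar> * 1)\<^sup>2 \<le> (\<Sum>x\<in>inner M. \<bar>h x\<bar>\<^sup>2) * (\<Sum>x\<in>inner M. 1\<^sup>2)"
    by (rule Cauchy_Schwarz_ineq_sum)
  also have "\<dots> = T * n" by (simp add: T_def n_def)
  also have "\<dots> \<le> n * ?\<sigma>\<^sup>2 / 4 * n" using T_le n by (intro mult_right_mono) auto
  also have "\<dots> = (n * ?\<sigma> / 2)\<^sup>2" by (simp add: power2_eq_square)
  finally have "(\<Sum>x\<in>inner M. \<bar>h x\<bar>)\<^sup>2 \<le> (n * ?\<sigma> / 2)\<^sup>2" by simp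
  then show ?thesis
    unfolding h_def n_def by (rule power2_le_imp_le) (use \<sigma> in simp)
qed

end

lemma second_singular_value_single_row:
  assumes "A \<in> carrier_mat n m" "n \<le> 1"
  shows "second_singular_value A = 0"
proof -
  have "A * transpose_mat A \<in> carrier_mat n n" using assms by auto
  then have "degree (char_poly (A * transpose_mat A)) \<le> 1"
    using degree_monic_char_poly assms(2) by metis
  then have "size (proots (char_poly (A * transpose_mat A))) \<le> 1"
    using size_proots_le order_trans by blast
  then have "length (singular_values A) \<le> 1"
    by (simp add: singular_values_def flip: size_mset)
  then show ?thesis by (simp add: second_singular_value_def)
qed

lemma spectral_expander_mean_deviation:
  fixes s :: "'y \<Rightarrow> real" and M :: "('y, 'x) bigraph"
  defines "f \<equiv> \<lambda>x. (\<Sum>x'\<in>nbrs_of_inner M x. s x') / real (card (nbrs_of_inner M x))"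
  assumes expander: "spectral_expander l M"
    and nonempty: "inner M \<noteq> {}"
    and s: "\<And>x'. x' \<in> outer M \<Longrightarrow> 0 \<le> s x' \<and> s x' \<le> 1"
  shows "(\<Sum>x\<in>inner M. \<bar>f x - (\<Sum>x\<in>inner M. f x) / real (card (inner M))\<bar>) / real (card (inner M)) \<le> l / 2"
proof -
  obtain d where M: "is_bigraph M" "inner_regular d M" and l: "second_singular_value (norm_adj d M) \<le> l"
    using expander by (auto simp: spectral_expander_def)
  have pos: "card (inner M) > 0" using nonempty M by (simp add: is_bigraph_def card_gt_0_iff)
  show ?thesis
  proof (cases "2 \<le> card (inner M)")
    case True
    define g where "g x = (\<Sum>x'\<in>nbrs_of_inner M x. s x') / real d" for x
    have fg: "f x = g x" if "x \<in> inner M" for x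
      using that M by (simp add: f_def g_def inner_regular_def)
    have "(\<Sum>x\<in>inner M. \<bar>f x - (\<Sum>x\<in>inner M. f x) / real (card (inner M))\<bar>)
       = (\<Sum>x\<in>inner M. \<bar>g x - (\<Sum>x\<in>inner M. g x) / real (card (inner M))\<bar>)"
      by (simp add: fg)
    also have "\<dots> \<le> real (card (inner M)) * second_singular_value (norm_adj d M) / 2"
      unfolding g_def by (rule deviation_le_second_singular_value[OF M True s])
    also have "\<dots> \<le> real (card (inner M)) * l / 2"
      using l by (simp add: mult_left_mono)
    finally show ?thesis using pos by (simp add: divide_le_eq mult_ac)
  next
    case False
    then have "card (inner M) = 1" using pos by simp
    then obtain x where x: "inner M = {x}" by (auto simp: card_1_singleton_iff)
    \<comment> \<open>With one inner vertex the deviation is zero; the convention for a missing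
      second singular value supplies \<open>0 \<le> l\<close>.\<close>
    have "second_singular_value (norm_adj d M) = 0"
      by (rule second_singular_value_single_row[of _ 1 "card (outer M)"]) (simp_all add: norm_adj_def x)
    then show ?thesis using l x by simp
  qed
qed

section \<open>Expectations over finite distributions\<close>

lemma expectation_cong_set_pmf:
  fixes f g :: "'a \<Rightarrow> real"
  assumes "\<And>x. x \<in> set_pmf p \<Longrightarrow> f x = g x"
  shows "measure_pmf.expectation p f = measure_pmf.expectation p g"
  using assms by (intro integral_cong_AE) (auto simp: AE_measure_pmf_iff)

lemma expectation_bind_pmf_finite:
  fixes h :: "'b \<Rightarrow> real"
  assumes "finite (set_pmf p)" "\<And>x. x \<in> set_pmf p \<Longrightarrow> finite (set_pmf (q x))"
  shows "measure_pmf.expectation (bind_pmf p q) h =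
    measure_pmf.expectation p (\<lambda>x. measure_pmf.expectation (q x) h)"
  using assms by (simp add: pmf_expectation_bind[of "set_pmf p"] integral_measure_pmf[of "set_pmf p"])

lemma expectation_mono_finite:
  fixes f g :: "'a \<Rightarrow> real"
  assumes "finite (set_pmf p)" "\<And>x. x \<in> set_pmf p \<Longrightarrow> f x \<le> g x"
  shows "measure_pmf.expectation p f \<le> measure_pmf.expectation p g"
  using assms by (intro integral_mono_AE integrable_measure_pmf_finite) (auto simp: AE_measure_pmf_iff)

text \<open>With \<open>T\<close> and \<open>C\<close> the products of the \<open>t i x\<close> and
  of the \<open>c i\<close>, \<open>T * w = v * T + (T - C) * (w - v) + C * (w - v)\<close>. The
  middle term is at most the sum of the deviations, since \<open>w - v\<close> has modulus at most
  1; the last has nonpositive expectation, as \<open>C\<close> is a nonnegative constant.\<close>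

lemma expectation_prod_times_le:
  fixes t :: "'i \<Rightarrow> 'b \<Rightarrow> real" and w :: "'b \<Rightarrow> real"
  assumes fin: "finite (set_pmf p)"
    and t: "\<And>i x. i \<in> I \<Longrightarrow> x \<in> set_pmf p \<Longrightarrow> 0 \<le> t i x \<and> t i x \<le> 1"
    and c: "\<And>i. i \<in> I \<Longrightarrow> 0 \<le> c i \<and> c i \<le> 1"
    and w: "\<And>x. x \<in> set_pmf p \<Longrightarrow> 0 \<le> w x \<and> w x \<le> 1"
    and v: "measure_pmf.expectation p w \<le> v" "v \<le> 1"
  shows "measure_pmf.expectation p (\<lambda>x. (\<Prod>i\<in>I. t i x) * w x) \<le>
    v * measure_pmf.expectation p (\<lambda>x. \<Prod>i\<in>I. t i x) +
    (\<Sum>i\<in>I. measure_pmf.expectation p (\<lambda>x. \<bar>t i x - c i\<bar>))"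
proof -
  \<comment> \<open>Subtracting \<open>v\<close> from \<open>w\<close> first makes the deviations be paid for only once.\<close>
  note int [simp] = integrable_measure_pmf_finite[OF fin]
  have "0 \<le> measure_pmf.expectation p w"
    using expectation_mono_finite[OF fin, of "\<lambda>_. 0" w] w by simp
  then have v0: "0 \<le> v" using v by simp
  have "measure_pmf.expectation p (\<lambda>x. (\<Prod>i\<in>I. t i x) * w x) \<le> measure_pmf.expectation p (\<lambda>x.
      v * (\<Prod>i\<in>I. t i x) + (\<Sum>i\<in>I. \<bar>t i x - c i\<bar>) + (\<Prod>i\<in>I. c i) * (w x - v))"
  proof (rule expectation_mono_finite[OF fin])
    fix x assume x: "x \<in> set_pmf p"
    \<comment> \<open>Exchanging the factors one at a time costs at most one deviation each, as all
      factors lie in \<open>[0, 1]\<close>.\<close>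
    have "\<bar>(\<Prod>i\<in>I. t i x) - (\<Prod>i\<in>I. c i)\<bar> \<le> (\<Sum>i\<in>I. \<bar>t i x - c i\<bar>)"
      using norm_prod_diff[of I "\<lambda>i. t i x" c] t[OF _ x] c by (simp add: abs_le_iff)
    moreover have "\<bar>w x - v\<bar> \<le> 1" using w[OF x] v0 v by (simp add: abs_le_iff)
    ultimately have "\<bar>(\<Prod>i\<in>I. t i x) - (\<Prod>i\<in>I. c i)\<bar> * \<bar>w x - v\<bar> \<le> (\<Sum>i\<in>I. \<bar>t i x - c i\<bar>) * 1"
      by (intro mult_mono) (auto intro: sum_nonneg)
    then have "((\<Prod>i\<in>I. t i x) - (\<Prod>i\<in>I. c i)) * (w x - v) \<le> (\<Sum>i\<in>I. \<bar>t i x - c i\<bar>)"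
      unfolding abs_mult[symmetric] by (simp add: abs_le_iff)
    then show "(\<Prod>i\<in>I. t i x) * w x \<le>
        v * (\<Prod>i\<in>I. t i x) + (\<Sum>i\<in>I. \<bar>t i x - c i\<bar>) + (\<Prod>i\<in>I. c i) * (w x - v)"
      by (simp add: algebra_simps)
  qed
  also have "\<dots> = v * measure_pmf.expectation p (\<lambda>x. \<Prod>i\<in>I. t i x)
      + (\<Sum>i\<in>I. measure_pmf.expectation p (\<lambda>x. \<bar>t i x - c i\<bar>))
      + (\<Prod>i\<in>I. c i) * (measure_pmf.expectation p w - v)"
    by simp
  also have "(\<Prod>i\<in>I. c i) * (measure_pmf.expectation p w - v) \<le> 0"
    using c v by (intro mult_nonneg_nonpos prod_nonneg) auto
  finally show ?thesis by simp
qed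

section \<open>Reduction to the inner game\<close>

text \<open>Nonempty finite neighbourhoods make \<open>pmf_of_set\<close> the uniform distribution;
  the spectral bound enters through \<open>inner_total_deviation\<close>.\<close>

locale concatenated_game =
  fixes G :: "('x, 'a) game" and M :: "nat \<Rightarrow> ('y, 'x) bigraph"
  assumes game: "is_game G"
    and concatenable: "concatenable G M"
    and bigraph: "i \<in> {1..players G} \<Longrightarrow> is_bigraph (M i)"
    and nbrs_nonempty: "i \<in> {1..players G} \<Longrightarrow> x \<in> questions G i \<Longrightarrow> nbrs_of_inner (M i) x \<noteq> {}"
begin

abbreviation I :: "nat set" where "I \<equiv> {1..players G}"

lemma finite_sets:
  assumes "i \<in> I"
  shows "finite (questions G i)" "finite (answers G i)" "finite (outer (M i))"
  using assms game bigraph[OF assms] by (auto simp: is_game_def is_bigraph_def)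

lemma question_mem: "x \<in> set_pmf (qdist G) \<Longrightarrow> i \<in> I \<Longrightarrow> x i \<in> questions G i"
  using game unfolding is_game_def by (blast dest: PiE_mem)

lemma finite_qdist: "finite (set_pmf (qdist G))"
  using game by (auto simp: is_game_def intro: finite_subset[OF _ finite_PiE])

lemma nbrs_subset:
  assumes "i \<in> I"
  shows "nbrs_of_inner (M i) x \<subseteq> outer (M i)" "nbrs_of_outer (M i) x' \<subseteq> questions G i"
  using assms bigraph[OF assms] concatenable
  by (auto simp: is_bigraph_def concatenable_def nbrs_of_inner_def nbrs_of_outer_def)

lemma finite_nbrs:
  assumes "i \<in> I"
  shows "finite (nbrs_of_inner (M i) x)" "finite (nbrs_of_outer (M i) x')"
  by (rule finite_subset[OF nbrs_subset(1)[OF assms] finite_sets(3)[OF assms]],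
      rule finite_subset[OF nbrs_subset(2)[OF assms] finite_sets(1)[OF assms]])

lemma finite_outer_answers: "i \<in> I \<Longrightarrow> finite (outer_answers G M i x')"
  unfolding outer_answers_def by (intro finite_PiE finite_nbrs finite_sets)

section \<open>Substrategies seen from the inner game\<close>

text \<open>The weight with which player \<open>i\<close> in effect answers the inner question
  \<open>x\<close> by \<open>a\<close>, averaged over the outer question.\<close>

definition marginal :: "(nat \<Rightarrow> 'y \<Rightarrow> ('x \<Rightarrow> 'a) \<Rightarrow> real) \<Rightarrow> nat \<Rightarrow> 'x \<Rightarrow> 'a \<Rightarrow> real" where
  "marginal f i x a = measure_pmf.expectation (pmf_of_set (nbrs_of_inner (M i) x))
     (\<lambda>x'. \<Sum>a' | a' \<in> outer_answers G M i x' \<and> a' x = a. f i x' a')"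

definition win_weight :: "(nat \<Rightarrow> 'x \<Rightarrow> 'a \<Rightarrow> real) \<Rightarrow> (nat \<Rightarrow> 'x) \<Rightarrow> real" where
  "win_weight F x = (\<Sum>a\<in>(\<Pi>\<^sub>E i\<in>I. answers G i). of_bool (wins G a x) * (\<Prod>i\<in>I. F i (x i) (a i)))"

lemma substrategy_nonneg:
  assumes "classical_substrategy G M f" "i \<in> I" "x' \<in> outer (M i)" "a' \<in> outer_answers G M i x'"
  shows "0 \<le> f i x' a'"
  using assms by (auto simp: classical_substrategy_def)

lemma set_pmf_nbrs:
  "i \<in> I \<Longrightarrow> x \<in> questions G i \<Longrightarrow> set_pmf (pmf_of_set (nbrs_of_inner (M i) x)) = nbrs_of_inner (M i) x"
  using nbrs_nonempty finite_nbrs by simp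

lemma expectation_nbrs:
  "i \<in> I \<Longrightarrow> x \<in> questions G i \<Longrightarrow>
    measure_pmf.expectation (pmf_of_set (nbrs_of_inner (M i) x)) h =
    (\<Sum>x'\<in>nbrs_of_inner (M i) x. h x') / real (card (nbrs_of_inner (M i) x))"
  using nbrs_nonempty finite_nbrs by (simp add: integral_pmf_of_set)

lemma sum_answers_by_value:
  assumes "i \<in> I" "x' \<in> nbrs_of_inner (M i) x"
  shows "(\<Sum>a\<in>answers G i. \<Sum>a' | a' \<in> outer_answers G M i x' \<and> a' x = a. h a') =
    (\<Sum>a'\<in>outer_answers G M i x'. h a')"
  using assms
  by (intro sum.group finite_outer_answers finite_sets)
    (auto simp: outer_answers_def nbrs_of_inner_def nbrs_of_outer_def)

text \<open>Tuples of maps are grouped by their values at \<open>x\<close>. Winning is constant on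
  each group, and a group is a product of one set per player, so the sum factorises.\<close>

lemma sum_joint_answers:
  fixes f :: "nat \<Rightarrow> 'y \<Rightarrow> ('x \<Rightarrow> 'a) \<Rightarrow> real"
  assumes x': "\<And>i. i \<in> I \<Longrightarrow> x' i \<in> nbrs_of_inner (M i) (x i)"
  shows "(\<Sum>a' \<in> (\<Pi>\<^sub>E i\<in>I. outer_answers G M i (x' i)).
       of_bool (wins G (\<lambda>i\<in>I. a' i (x i)) x) * (\<Prod>i\<in>I. f i (x' i) (a' i))) =
     (\<Sum>a\<in>(\<Pi>\<^sub>E i\<in>I. answers G i). of_bool (wins G a x) *
        (\<Prod>i\<in>I. \<Sum>a' | a' \<in> outer_answers G M i (x' i) \<and> a' (x i) = a i. f i (x' i) a'))"
proof -
  let ?O = "\<Pi>\<^sub>E i\<in>I. outer_answers G M i (x' i)" and ?A = "\<Pi>\<^sub>E i\<in>I. answers G i"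
  let ?h = "\<lambda>a'. of_bool (wins G (\<lambda>i\<in>I. a' i (x i)) x) * (\<Prod>i\<in>I. f i (x' i) (a' i))"
  have mem: "(\<lambda>i\<in>I. a' i (x i)) \<in> ?A" if "a' \<in> ?O" for a'
  proof (intro restrict_PiE_iff[THEN iffD2] ballI)
    fix i assume i: "i \<in> I"
    then have "a' i \<in> outer_answers G M i (x' i)" using that by auto
    moreover have "x i \<in> nbrs_of_outer (M i) (x' i)"
      using x'[OF i] by (simp add: nbrs_of_inner_def nbrs_of_outer_def)
    ultimately show "a' i (x i) \<in> answers G i" by (auto simp: outer_answers_def)
  qed
  have "sum ?h ?O = (\<Sum>a\<in>?A. \<Sum>a' | a' \<in> ?O \<and> (\<lambda>i\<in>I. a' i (x i)) = a. ?h a')"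
    by (intro sum.group[symmetric] finite_PiE image_subsetI mem finite_outer_answers finite_sets) simp_all
  also have "\<dots> = (\<Sum>a\<in>?A. of_bool (wins G a x) *
        (\<Prod>i\<in>I. \<Sum>a' | a' \<in> outer_answers G M i (x' i) \<and> a' (x i) = a i. f i (x' i) a'))"
  proof (rule sum.cong[OF refl])
    fix a assume a: "a \<in> ?A"
    have eq: "{a' \<in> ?O. (\<lambda>i\<in>I. a' i (x i)) = a} =
        (\<Pi>\<^sub>E i\<in>I. {a' \<in> outer_answers G M i (x' i). a' (x i) = a i})"
      using a by (auto simp: PiE_iff fun_eq_iff restrict_def extensional_def)
    have "(\<Sum>a' | a' \<in> ?O \<and> (\<lambda>i\<in>I. a' i (x i)) = a. ?h a') =
        (\<Sum>a' | a' \<in> ?O \<and> (\<lambda>i\<in>I. a' i (x i)) = a. of_bool (wins G a x) * (\<Prod>i\<in>I. f i (x' i) (a' i)))"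
      by (intro sum.cong) auto
    also have "\<dots> = of_bool (wins G a x) *
        (\<Sum>a' \<in> (\<Pi>\<^sub>E i\<in>I. {a' \<in> outer_answers G M i (x' i). a' (x i) = a i}). \<Prod>i\<in>I. f i (x' i) (a' i))"
      unfolding eq by (rule sum_distrib_left[symmetric])
    also have "(\<Sum>a' \<in> (\<Pi>\<^sub>E i\<in>I. {a' \<in> outer_answers G M i (x' i). a' (x i) = a i}). \<Prod>i\<in>I. f i (x' i) (a' i)) =
        (\<Prod>i\<in>I. \<Sum>a' | a' \<in> outer_answers G M i (x' i) \<and> a' (x i) = a i. f i (x' i) a')"
      by (rule prod_sum_PiE[symmetric]) (auto intro: finite_subset[OF _ finite_outer_answers])
    finally show "(\<Sum>a' | a' \<in> ?O \<and> (\<lambda>i\<in>I. a' i (x i)) = a. ?h a') = of_bool (wins G a x) *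
        (\<Prod>i\<in>I. \<Sum>a' | a' \<in> outer_answers G M i (x' i) \<and> a' (x i) = a i. f i (x' i) a')" .
  qed
  finally show ?thesis .
qed

text \<open>Given \<open>x\<close>, the outer questions are independent, so the expectation of the
  factorised sum is a product of expectations, one marginal per player.\<close>

lemma substrategy_value_eq:
  assumes f: "classical_substrategy G M f"
  shows "substrategy_value G M f = measure_pmf.expectation (qdist G) (win_weight (marginal f))"
proof -
  let ?P = "\<lambda>x. Pi_pmf I undefined (\<lambda>i. pmf_of_set (nbrs_of_inner (M i) (x i)))"
  have set_P: "set_pmf (?P x) = PiE_dflt I undefined (\<lambda>i. nbrs_of_inner (M i) (x i))"
    if "x \<in> set_pmf (qdist G)" for x
    using that question_mem set_pmf_nbrs by (subst set_Pi_pmf) (auto simp: PiE_dflt_def)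
  have fin_P: "finite (set_pmf (?P x))" if "x \<in> set_pmf (qdist G)" for x
    unfolding set_P[OF that] using finite_nbrs by (intro finite_PiE_dflt) auto
  have "substrategy_value G M f = measure_pmf.expectation (qdist G) (\<lambda>x. measure_pmf.expectation (?P x) (\<lambda>x'.
      \<Sum>a' \<in> (\<Pi>\<^sub>E i\<in>I. outer_answers G M i (x' i)).
         of_bool (wins G (\<lambda>i\<in>I. a' i (x i)) x) * (\<Prod>i\<in>I. f i (x' i) (a' i))))"
    unfolding substrategy_value_def referee_def
    using finite_qdist fin_P
    by (simp add: expectation_bind_pmf_finite cong: expectation_cong_set_pmf)
  also have "\<dots> = measure_pmf.expectation (qdist G) (win_weight (marginal f))"
  proof (rule expectation_cong_set_pmf)
    fix x assume x: "x \<in> set_pmf (qdist G)"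
    note int [simp] = integrable_measure_pmf_finite[OF fin_P[OF x]]
    define h where "h a i y' = (\<Sum>a' | a' \<in> outer_answers G M i y' \<and> a' (x i) = a i. f i y' a')"
      for a i y'
    have "measure_pmf.expectation (?P x) (\<lambda>x'. \<Sum>a' \<in> (\<Pi>\<^sub>E i\<in>I. outer_answers G M i (x' i)).
         of_bool (wins G (\<lambda>i\<in>I. a' i (x i)) x) * (\<Prod>i\<in>I. f i (x' i) (a' i))) =
       measure_pmf.expectation (?P x) (\<lambda>x'. \<Sum>a\<in>(\<Pi>\<^sub>E i\<in>I. answers G i). of_bool (wins G a x) *
          (\<Prod>i\<in>I. h a i (x' i)))"
      unfolding h_def
      by (intro expectation_cong_set_pmf sum_joint_answers) (use set_P[OF x] in \<open>auto simp: PiE_dflt_def\<close>)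
    also have "\<dots> = (\<Sum>a\<in>(\<Pi>\<^sub>E i\<in>I. answers G i). of_bool (wins G a x) *
         measure_pmf.expectation (?P x) (\<lambda>x'. \<Prod>i\<in>I. h a i (x' i)))"
      by (simp only: Bochner_Integration.integral_sum[OF int] integral_mult_right_zero)
    also have "\<dots> = (\<Sum>a\<in>(\<Pi>\<^sub>E i\<in>I. answers G i). of_bool (wins G a x) *
         (\<Prod>i\<in>I. measure_pmf.expectation (pmf_of_set (nbrs_of_inner (M i) (x i))) (h a i)))"
    \<comment> \<open>The product rule asks for nonnegative factors on the support; there the outer
      questions are vertices at which \<open>f\<close> is constrained.\<close>
    proof (intro sum.cong refl arg_cong2[where f = "(*)"] expectation_prod_Pi_pmf)
      fix a i y assume i: "i \<in> I"
      note q = question_mem[OF x i]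
      show "integrable (measure_pmf (pmf_of_set (nbrs_of_inner (M i) (x i)))) (h a i)"
        by (rule integrable_measure_pmf_finite) (simp add: set_pmf_nbrs[OF i q] finite_nbrs[OF i])
      assume "y \<in> set_pmf (pmf_of_set (nbrs_of_inner (M i) (x i)))"
      then have "y \<in> outer (M i)" using nbrs_subset[OF i] by (auto simp: set_pmf_nbrs[OF i q])
      then show "0 \<le> h a i y"
        unfolding h_def using substrategy_nonneg[OF f i] by (auto intro!: sum_nonneg)
    qed simp
    finally show "measure_pmf.expectation (?P x) (\<lambda>x'. \<Sum>a' \<in> (\<Pi>\<^sub>E i\<in>I. outer_answers G M i (x' i)).
         of_bool (wins G (\<lambda>i\<in>I. a' i (x i)) x) * (\<Prod>i\<in>I. f i (x' i) (a' i))) =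
       win_weight (marginal f) x"
      by (simp only: win_weight_def marginal_def h_def[abs_def])
  qed
  finally show ?thesis .
qed

lemma inner_total_eq_sum_marginal:
  assumes "i \<in> I" "x \<in> questions G i"
  shows "inner_total G M f i x = (\<Sum>a\<in>answers G i. marginal f i x a)"
proof -
  have "(\<Sum>a\<in>answers G i. marginal f i x a) = (\<Sum>x'\<in>nbrs_of_inner (M i) x.
      \<Sum>a\<in>answers G i. \<Sum>a' | a' \<in> outer_answers G M i x' \<and> a' x = a. f i x' a')
      / real (card (nbrs_of_inner (M i) x))"
    unfolding marginal_def expectation_nbrs[OF assms] sum_divide_distrib[symmetric]
    by (subst sum.swap) simp
  also have "\<dots> = inner_total G M f i x"
    unfolding inner_total_def expectation_nbrs[OF assms] using assms
    by (simp add: sum_answers_by_value)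
  finally show ?thesis by simp
qed

lemma marginal_nonneg:
  assumes f: "classical_substrategy G M f" and i: "i \<in> I" and x: "x \<in> questions G i"
  shows "0 \<le> marginal f i x a"
  unfolding marginal_def expectation_nbrs[OF i x]
  by (intro divide_nonneg_nonneg sum_nonneg)
    (use substrategy_nonneg[OF f i] subsetD[OF nbrs_subset(1)[OF i]] in auto)

lemma inner_total_bounds:
  assumes f: "classical_substrategy G M f" and i: "i \<in> I" and x: "x \<in> questions G i"
  shows "0 \<le> inner_total G M f i x" "inner_total G M f i x \<le> 1"
proof -
  show "0 \<le> inner_total G M f i x"
    unfolding inner_total_eq_sum_marginal[OF i x] by (intro sum_nonneg marginal_nonneg assms)
  have "(\<Sum>x'\<in>nbrs_of_inner (M i) x. \<Sum>a'\<in>outer_answers G M i x'. f i x' a') \<le>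
      (\<Sum>x'\<in>nbrs_of_inner (M i) x. 1)"
    using f i subsetD[OF nbrs_subset(1)[OF i]] unfolding classical_substrategy_def
    by (intro sum_mono) blast
  then show "inner_total G M f i x \<le> 1"
    unfolding inner_total_def expectation_nbrs[OF i x]
    using nbrs_nonempty[OF i x] finite_nbrs[OF i] by (simp add: divide_le_eq card_gt_0_iff)
qed

lemma complete_inner_total:
  assumes f: "complete_strategy G M f" and i: "i \<in> I" and x: "x \<in> questions G i"
  shows "inner_total G M f i x = 1"
proof -
  have "(\<Sum>x'\<in>nbrs_of_inner (M i) x. \<Sum>a'\<in>outer_answers G M i x'. f i x' a') =
      (\<Sum>x'\<in>nbrs_of_inner (M i) x. 1)"
    using f i subsetD[OF nbrs_subset(1)[OF i]] unfolding complete_strategy_def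
    by (intro sum.cong) blast+
  then show ?thesis
    unfolding inner_total_def expectation_nbrs[OF i x]
    using nbrs_nonempty[OF i x] finite_nbrs[OF i] by simp
qed

text \<open>Without the winning predicate, the sum of products is a product of totals, all equal to
  1.\<close>

lemma win_weight_bounds:
  assumes F: "\<And>i a. i \<in> I \<Longrightarrow> a \<in> answers G i \<Longrightarrow> 0 \<le> F i (x i) a"
    and total: "\<And>i. i \<in> I \<Longrightarrow> (\<Sum>a\<in>answers G i. F i (x i) a) = 1"
  shows "0 \<le> win_weight F x" "win_weight F x \<le> 1"
proof -
  have prod: "0 \<le> (\<Prod>i\<in>I. F i (x i) (a i))" if "a \<in> (\<Pi>\<^sub>E i\<in>I. answers G i)" for a
    using that F by (intro prod_nonneg) (auto simp: PiE_iff)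
  then show "0 \<le> win_weight F x"
    unfolding win_weight_def by (intro sum_nonneg) auto
  have "win_weight F x \<le> (\<Sum>a\<in>(\<Pi>\<^sub>E i\<in>I. answers G i). \<Prod>i\<in>I. F i (x i) (a i))"
    unfolding win_weight_def using prod by (intro sum_mono) (auto simp: of_bool_def)
  also have "\<dots> = (\<Prod>i\<in>I. \<Sum>a\<in>answers G i. F i (x i) a)"
    by (rule prod_sum_PiE[symmetric]) (auto intro: finite_sets)
  also have "\<dots> = 1" by (simp add: total)
  finally show "win_weight F x \<le> 1" .
qed

lemma complete_win_weight_bounds:
  assumes f: "complete_strategy G M f" and x: "x \<in> set_pmf (qdist G)"
  shows "0 \<le> win_weight (marginal f) x" "win_weight (marginal f) x \<le> 1"
proof -
  have sub: "classical_substrategy G M f" using f by (simp add: complete_strategy_def)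
  have "\<And>i a. i \<in> I \<Longrightarrow> 0 \<le> marginal f i (x i) a"
    using marginal_nonneg[OF sub] question_mem[OF x] by auto
  moreover have "(\<Sum>a\<in>answers G i. marginal f i (x i) a) = 1" if "i \<in> I" for i
    using complete_inner_total[OF f that question_mem[OF x that]]
    by (simp add: inner_total_eq_sum_marginal[OF that question_mem[OF x that]])
  ultimately show "0 \<le> win_weight (marginal f) x" "win_weight (marginal f) x \<le> 1"
    using win_weight_bounds[of "marginal f" x] by blast+
qed

section \<open>Complete strategies and the value of the concatenated game\<close>

lemma complete_value_le_1: "complete_strategy G M f \<Longrightarrow> substrategy_value G M f \<le> 1"
  using expectation_mono_finite[OF finite_qdist, of "win_weight (marginal f)" "\<lambda>_. 1"]
    complete_win_weight_bounds[of f]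
  by (simp add: substrategy_value_eq complete_strategy_def)

text \<open>
  Given the question \<open>x'\<close>, the player draws the answers to all the possible inner questions
  independently.
\<close>

lemma complete_strategy_with_marginal:
  assumes F: "\<And>i x a. i \<in> I \<Longrightarrow> x \<in> questions G i \<Longrightarrow> a \<in> answers G i \<Longrightarrow> 0 \<le> F i x a"
    and total: "\<And>i x. i \<in> I \<Longrightarrow> x \<in> questions G i \<Longrightarrow> (\<Sum>a\<in>answers G i. F i x a) = 1"
  obtains g where "complete_strategy G M g"
    "\<And>i x a. i \<in> I \<Longrightarrow> x \<in> questions G i \<Longrightarrow> a \<in> answers G i \<Longrightarrow> marginal g i x a = F i x a"
proof
  define g where "g i x' a' = (\<Prod>x\<in>nbrs_of_outer (M i) x'. F i x (a' x))" for i x' a'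
  have nonneg: "0 \<le> g i x' a'" if "i \<in> I" "a' \<in> outer_answers G M i x'" for i x' a'
    unfolding g_def
  proof (rule prod_nonneg)
    fix x assume x: "x \<in> nbrs_of_outer (M i) x'"
    then have "a' x \<in> answers G i" using that(2) by (auto simp: outer_answers_def)
    then show "0 \<le> F i x (a' x)" by (rule F[OF that(1) subsetD[OF nbrs_subset(2)[OF that(1)] x]])
  qed
  have sum_g: "(\<Sum>a'\<in>outer_answers G M i x'. g i x' a') = 1" if i: "i \<in> I" for i x'
  proof -
    have "(\<Sum>a'\<in>outer_answers G M i x'. g i x' a') =
        (\<Prod>x\<in>nbrs_of_outer (M i) x'. \<Sum>a\<in>answers G i. F i x a)"
      unfolding outer_answers_def g_def
      by (rule prod_sum_PiE[symmetric]) (use finite_nbrs finite_sets i in auto)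
    also have "\<dots> = 1"
      using total[OF i] nbrs_subset[OF i] by (intro prod.neutral) blast
    finally show ?thesis .
  qed
  show "complete_strategy G M g"
    using nonneg sum_g by (simp add: complete_strategy_def classical_substrategy_def)
  fix i x a assume i: "i \<in> I" and x: "x \<in> questions G i" and a: "a \<in> answers G i"
  have "(\<Sum>a' | a' \<in> outer_answers G M i x' \<and> a' x = a. g i x' a') = F i x a"
    if x': "x' \<in> nbrs_of_inner (M i) x" for x'
  proof -
    let ?N = "nbrs_of_outer (M i) x'"
    have xN: "x \<in> ?N" using x' by (simp add: nbrs_of_inner_def nbrs_of_outer_def)
    \<comment> \<open>Fixing the value at \<open>x\<close> shrinks one coordinate of the product to
      \<open>{a}\<close>; every other coordinate then sums to 1.\<close>
    have "{a' \<in> outer_answers G M i x'. a' x = a} = (\<Pi>\<^sub>E y\<in>?N. if y = x then {a} else answers G i)"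
    proof (intro equalityI subsetI)
      fix b assume b: "b \<in> (\<Pi>\<^sub>E y\<in>?N. if y = x then {a} else answers G i)"
      have "b y \<in> answers G i" if "y \<in> ?N" for y
        using PiE_mem[OF b that] a by (auto split: if_splits)
      moreover have "b x = a" using PiE_mem[OF b xN] by simp
      ultimately show "b \<in> {a' \<in> outer_answers G M i x'. a' x = a}"
        using b by (simp add: outer_answers_def PiE_iff)
    qed (auto simp: outer_answers_def PiE_iff)
    then have "(\<Sum>a' | a' \<in> outer_answers G M i x' \<and> a' x = a. g i x' a') =
        (\<Prod>y\<in>?N. \<Sum>b\<in>(if y = x then {a} else answers G i). F i y b)"
      using prod_sum_PiE[of ?N "\<lambda>y. if y = x then {a} else answers G i" "F i"] finite_nbrs[OF i] finite_sets[OF i]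
      by (simp add: g_def)
    also have "\<dots> = (\<Prod>y\<in>?N. if y = x then F i x a else 1)"
      using total[OF i] subsetD[OF nbrs_subset(2)[OF i]] by (intro prod.cong) auto
    also have "\<dots> = F i x a" using xN finite_nbrs[OF i] by simp
    finally show ?thesis .
  qed
  then show "marginal g i x a = F i x a"
    unfolding marginal_def expectation_nbrs[OF i x]
    using nbrs_nonempty[OF i x] finite_nbrs[OF i] by simp
qed

lemma win_weight_cong:
  assumes "\<And>i a. i \<in> I \<Longrightarrow> a \<in> answers G i \<Longrightarrow> F i (x i) a = F' i (x i) a"
  shows "win_weight F x = win_weight F' x"
  unfolding win_weight_def using assms
  by (intro sum.cong prod.cong arg_cong2[where f = "(*)"] refl) (auto simp: PiE_iff)

text \<open>An inner strategy lifts to a complete strategy of the same value. Its existence also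
  makes the supremum one over a nonempty set, so that the bound 1 carries over to
  \<open>concat_value\<close>.\<close>

lemma expectation_win_weight_le_concat_value:
  assumes F: "\<And>i x a. i \<in> I \<Longrightarrow> x \<in> questions G i \<Longrightarrow> a \<in> answers G i \<Longrightarrow> 0 \<le> F i x a"
    and total: "\<And>i x. i \<in> I \<Longrightarrow> x \<in> questions G i \<Longrightarrow> (\<Sum>a\<in>answers G i. F i x a) = 1"
  shows "measure_pmf.expectation (qdist G) (win_weight F) \<le> concat_value G M" "concat_value G M \<le> 1"
proof -
  obtain g where g: "complete_strategy G M g"
    and marg: "\<And>i x a. i \<in> I \<Longrightarrow> x \<in> questions G i \<Longrightarrow> a \<in> answers G i \<Longrightarrow> marginal g i x a = F i x a"
    using complete_strategy_with_marginal[of F, OF F total] by blast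
  have "measure_pmf.expectation (qdist G) (win_weight F) =
      measure_pmf.expectation (qdist G) (win_weight (marginal g))"
    by (intro expectation_cong_set_pmf win_weight_cong) (simp add: marg question_mem)
  also have "\<dots> = substrategy_value G M g"
    using g by (simp add: substrategy_value_eq complete_strategy_def)
  also have "\<dots> \<le> concat_value G M"
    unfolding concat_value_def
    by (rule cSUP_upper) (use g complete_value_le_1 in \<open>auto intro!: bdd_aboveI2[where M = 1]\<close>)
  finally show "measure_pmf.expectation (qdist G) (win_weight F) \<le> concat_value G M" .
  show "concat_value G M \<le> 1"
    unfolding concat_value_def by (rule cSUP_least) (use g complete_value_le_1 in auto)
qed

section \<open>The fortification bound in terms of mean deviations\<close>

text \<open>Dividing the marginals by their totals turns \<open>f\<close> into an inner strategy
  \<open>F\<close>; the totals factor out of the winning weight, which leaves the situation of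
  \<open>expectation_prod_times_le\<close>.\<close>

lemma substrategy_value_le:
  assumes f: "classical_substrategy G M f"
    and c: "\<And>i. i \<in> I \<Longrightarrow> 0 \<le> c i \<and> c i \<le> 1"
  shows "substrategy_value G M f \<le>
    concat_value G M * measure_pmf.expectation (qdist G) (\<lambda>x. \<Prod>i\<in>I. inner_total G M f i (x i)) +
    (\<Sum>i\<in>I. measure_pmf.expectation (qdist G) (\<lambda>x. \<bar>inner_total G M f i (x i) - c i\<bar>))"
proof (cases "\<exists>i\<in>I. answers G i = {}")
  \<comment> \<open>An empty answer set admits no normalisation and no complete strategy, but the
    value is 0 and \<open>concat_value\<close> is multiplied by 0, because the totals of player
    \<open>j\<close> vanish.\<close>
  case True
  then obtain j where j: "j \<in> I" "answers G j = {}" by blast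
  then have "(\<Pi>\<^sub>E i\<in>I. answers G i) = {}" by (auto simp: PiE_eq_empty_iff)
  then have "substrategy_value G M f = 0"
    unfolding substrategy_value_eq[OF f] win_weight_def by simp
  moreover have "(\<Prod>i\<in>I. inner_total G M f i (x i)) = 0" if "x \<in> set_pmf (qdist G)" for x
  proof (rule prod_zero)
    show "\<exists>i\<in>I. inner_total G M f i (x i) = 0"
      using j inner_total_eq_sum_marginal[OF j(1) question_mem[OF that j(1)]] by (intro bexI[of _ j]) auto
  qed simp
  then have "measure_pmf.expectation (qdist G) (\<lambda>x. \<Prod>i\<in>I. inner_total G M f i (x i)) =
      measure_pmf.expectation (qdist G) (\<lambda>_. 0)"
    by (rule expectation_cong_set_pmf)
  ultimately show ?thesis by (auto intro!: sum_nonneg)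
next
  case False
  define t where "t i x = inner_total G M f i x" for i x
  \<comment> \<open>Where the total is 0, all marginals vanish by nonnegativity, so the uniform
    default keeps \<open>F_marginal\<close> true.\<close>
  define F where "F i x a = (if t i x = 0 then 1 / real (card (answers G i)) else marginal f i x a / t i x)"
    for i x a
  have F_nonneg: "0 \<le> F i x a" if "i \<in> I" "x \<in> questions G i" for i x a
    using marginal_nonneg[OF f that] inner_total_bounds[OF f that] by (simp add: F_def t_def)
  have F_total: "(\<Sum>a\<in>answers G i. F i x a) = 1" if "i \<in> I" "x \<in> questions G i" for i x
  proof (cases "t i x = 0")
    case True
    then show ?thesis using False that(1) finite_sets(2)[OF that(1)] by (simp add: F_def)
  next
    case nonzero: False
    then have "(\<Sum>a\<in>answers G i. F i x a) = (\<Sum>a\<in>answers G i. marginal f i x a) / t i x"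
      by (simp add: F_def sum_divide_distrib)
    then show ?thesis
      using nonzero inner_total_eq_sum_marginal[OF that, of f] by (simp add: t_def)
  qed
  have F_marginal: "marginal f i x a = t i x * F i x a"
    if "i \<in> I" "x \<in> questions G i" "a \<in> answers G i" for i x a
  proof (cases "t i x = 0")
    case True
    then have "\<forall>a\<in>answers G i. marginal f i x a = 0"
      using inner_total_eq_sum_marginal[OF that(1,2), of f] marginal_nonneg[OF f that(1,2)]
        finite_sets(2)[OF that(1)]
      by (simp add: t_def sum_nonneg_eq_0_iff)
    then show ?thesis using True that by simp
  qed (simp add: F_def)
  have "win_weight (marginal f) x = (\<Prod>i\<in>I. t i (x i)) * win_weight F x"
    if "x \<in> set_pmf (qdist G)" for x
  proof -
    have "win_weight (marginal f) x = win_weight (\<lambda>i x a. t i x * F i x a) x"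
      using that by (intro win_weight_cong) (simp add: F_marginal question_mem)
    then show ?thesis
      by (simp add: win_weight_def prod.distrib sum_distrib_left mult_ac)
  qed
  then have "substrategy_value G M f =
      measure_pmf.expectation (qdist G) (\<lambda>x. (\<Prod>i\<in>I. t i (x i)) * win_weight F x)"
    unfolding substrategy_value_eq[OF f] by (intro expectation_cong_set_pmf)
  also have "\<dots> \<le> concat_value G M * measure_pmf.expectation (qdist G) (\<lambda>x. \<Prod>i\<in>I. t i (x i)) +
    (\<Sum>i\<in>I. measure_pmf.expectation (qdist G) (\<lambda>x. \<bar>t i (x i) - c i\<bar>))"
  proof (rule expectation_prod_times_le[OF finite_qdist])
    fix i x assume "i \<in> I" "x \<in> set_pmf (qdist G)"
    then show "0 \<le> t i (x i) \<and> t i (x i) \<le> 1"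
      using inner_total_bounds[OF f] question_mem by (simp add: t_def)
  next
    fix x assume "x \<in> set_pmf (qdist G)"
    then show "0 \<le> win_weight F x \<and> win_weight F x \<le> 1"
      using win_weight_bounds[of F x] F_nonneg F_total question_mem by blast
  qed (use c expectation_win_weight_le_concat_value[of F, OF F_nonneg F_total] in auto)
  finally show ?thesis by (simp add: t_def)
qed

text \<open>The constant is the mean of the totals. Uniform marginals turn the expectation into an
  average over all inner questions, where the expander bound applies to the total mass of
  \<open>f\<close> at each outer question.\<close>

lemma inner_total_deviation:
  assumes f: "classical_substrategy G M f" and i: "i \<in> I"
    and uniform: "uniform_marginals G" and expander: "spectral_expander l (M i)"
  obtains c where "0 \<le> c" "c \<le> 1"
    "measure_pmf.expectation (qdist G) (\<lambda>x. \<bar>inner_total G M f i (x i) - c\<bar>) \<le> l / 2"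
proof
  let ?Q = "questions G i"
  define t where "t = inner_total G M f i"
  define c where "c = (\<Sum>x\<in>?Q. t x) / real (card ?Q)"
  define s where "s x' = (\<Sum>a'\<in>outer_answers G M i x'. f i x' a')" for x'
  have inner: "inner (M i) = ?Q" using concatenable i by (simp add: concatenable_def)
  obtain x0 where "x0 \<in> set_pmf (qdist G)" using set_pmf_not_empty[of "qdist G"] by blast
  then have Q: "?Q \<noteq> {}" "finite ?Q" using question_mem[OF _ i] finite_sets(1)[OF i] by auto
  then have pos: "card ?Q > 0" by (simp add: card_gt_0_iff)
  have t01: "0 \<le> t x \<and> t x \<le> 1" if "x \<in> ?Q" for x
    using inner_total_bounds[OF f i that] by (simp add: t_def)
  show "0 \<le> c" unfolding c_def using t01 by (intro divide_nonneg_nonneg sum_nonneg) auto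
  have "(\<Sum>x\<in>?Q. t x) \<le> (\<Sum>x\<in>?Q. 1)" using t01 by (intro sum_mono) auto
  then show "c \<le> 1" using pos by (simp add: c_def divide_le_eq)
  have s01: "0 \<le> s x' \<and> s x' \<le> 1" if "x' \<in> outer (M i)" for x'
    using f i that substrategy_nonneg[OF f i that]
    by (auto simp: s_def classical_substrategy_def intro: sum_nonneg)
  have t_eq: "t x = (\<Sum>x'\<in>nbrs_of_inner (M i) x. s x') / real (card (nbrs_of_inner (M i) x))" if "x \<in> ?Q" for x
    using expectation_nbrs[OF i that] by (simp add: t_def inner_total_def s_def)
  have "measure_pmf.expectation (qdist G) (\<lambda>x. \<bar>t (x i) - c\<bar>) =
      measure_pmf.expectation (map_pmf (\<lambda>x. x i) (qdist G)) (\<lambda>y. \<bar>t y - c\<bar>)"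
    by simp
  also have "map_pmf (\<lambda>x. x i) (qdist G) = pmf_of_set ?Q"
    using uniform i by (simp add: uniform_marginals_def)
  also have "measure_pmf.expectation (pmf_of_set ?Q) (\<lambda>y. \<bar>t y - c\<bar>) = (\<Sum>x\<in>?Q. \<bar>t x - c\<bar>) / real (card ?Q)"
    using Q by (simp add: integral_pmf_of_set)
  also have "\<dots> \<le> l / 2"
    using spectral_expander_mean_deviation[OF expander, of s] Q s01
    by (simp add: c_def inner t_eq)
  finally show "measure_pmf.expectation (qdist G) (\<lambda>x. \<bar>inner_total G M f i (x i) - c\<bar>) \<le> l / 2"
    by (simp add: t_def)
qed

end

theorem theorem5p2:
  fixes G :: "('x, 'a) game"
    and M :: "nat \<Rightarrow> ('y, 'x) bigraph"
    and l \<delta> :: real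
  assumes "is_game G"
    and "players G \<ge> 2"
    and "0 \<le> \<delta>" and "\<delta> \<le> 1"
    and "uniform_marginals G"
    and "concatenable G M"
    and "\<forall>i\<in>{1..players G}. spectral_expander l (M i)"
    and "l \<le> 2 * \<delta> / real (players G)"
  shows "\<forall>f. classical_substrategy G M f \<longrightarrow>
           substrategy_value G M f \<le>
             concat_value G M *
               measure_pmf.expectation (qdist G) (\<lambda>x. \<Prod>i\<in>{1..players G}. inner_total G M f i (x i))
             + \<delta>"
proof (intro allI impI)
  fix f assume f: "classical_substrategy G M f"
  interpret concatenated_game G M
  proof
    fix i x assume i: "i \<in> {1..players G}" and x: "x \<in> questions G i"
    obtain d where "inner_regular d (M i)"
      using bspec[OF assms(7) i] by (auto simp: spectral_expander_def)
    then have "card (nbrs_of_inner (M i) x) \<ge> 1"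
      using i x assms(6) by (auto simp: inner_regular_def concatenable_def)
    then show "nbrs_of_inner (M i) x \<noteq> {}" by auto
  qed (use assms in \<open>auto simp: spectral_expander_def\<close>)
  let ?dev = "\<lambda>i c. measure_pmf.expectation (qdist G) (\<lambda>x. \<bar>inner_total G M f i (x i) - c\<bar>)"
  have "\<exists>c. 0 \<le> c \<and> c \<le> 1 \<and> ?dev i c \<le> l / 2" if i: "i \<in> I" for i
    by (rule inner_total_deviation[OF f i assms(5) bspec[OF assms(7) i]]) blast
  then have "\<forall>i\<in>I. \<exists>c. 0 \<le> c \<and> c \<le> 1 \<and> ?dev i c \<le> l / 2" by blast
  from bchoice[OF this] obtain c where c: "\<And>i. i \<in> I \<Longrightarrow> 0 \<le> c i \<and> c i \<le> 1"
    and dev: "\<And>i. i \<in> I \<Longrightarrow> ?dev i (c i) \<le> l / 2"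
    by blast
  \<comment> \<open>Each of the \<open>players G\<close> deviations is at most \<open>l / 2\<close>,
    hence at most \<open>\<delta> / players G\<close>.\<close>
  have "(\<Sum>i\<in>I. ?dev i (c i)) \<le> (\<Sum>i\<in>I. l / 2)"
    by (intro sum_mono dev)
  also have "\<dots> \<le> \<delta>"
    using assms(2,8) by (simp add: field_simps)
  finally show "substrategy_value G M f \<le>
      concat_value G M *
        measure_pmf.expectation (qdist G) (\<lambda>x. \<Prod>i\<in>{1..players G}. inner_total G M f i (x i)) + \<delta>"
    using substrategy_value_le[of f c, OF f c] by simp
qed

end
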